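(* Let $\tau,\theta\in[0,1]$ and let $$\mathbf{q}=\left(\frac{4}{\theta+3},\ \frac{4}{2+\tau-\theta\tau},\ \frac{4}{3+\theta\tau-\theta-\tau}\right).$$ Then the optimal constant of the generalized Bohnenblust--Hille inequality for real scalars with exponent $\mathbf{q}$ (for $3$-linear forms) is $$C_{3,\mathbf{q}}^{\mathbb{R}}=2^{\frac{\theta+3}{4}}.$$
   Context: Let $c_0$ be the real Banach space of real null sequences with the supremum norm, with canonical unit vectors $(e_j)_{j\ge1}$, and for a continuous $3$-linear form $T:c_0\times c_0\times c_0\to\mathbb{R}$ put $\|T\|=\sup\{|T(z_1,z_2,z_3)|:\|z_k\|\le 1,\ k=1,2,3\}$. For $\mathbf{q}=(q_1,q_2,q_3)\in[1,2]^3$, $C_{3,\mathbf{q}}^{\mathbb{R}}$ denotes the optimal (smallest) constant $C$ such that $$\left(\sum_{j_1=1}^{N}\left(\sum_{j_2=1}^{N}\left(\sum_{j_3=1}^{N}\left|T(e_{j_1},e_{j_2},e_{j_3})\right|^{q_3}\right)^{\frac{q_2}{q_3}}\right)^{\frac{q_1}{q_2}}\right)^{\frac{1}{q_1}}\leq C\,\|T\|$$ for all continuous $3$-linear forms $T:c_0\times c_0\times c_0\to\mathbb{R}$ and all positive integers $N$. *)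

theory Defs
  imports "HOL-Analysis.Analysis"
begin

section \<open>The real Banach space of null sequences\<close>

text \<open>Coordinates are indexed by all natural numbers, starting from 0.\<close>

typedef c0 = "{x :: nat \<Rightarrow> real. x \<longlonglongrightarrow> 0}"
  morphisms coord Abs_c0
  by (rule exI[of _ "\<lambda>_. 0"]) simp

setup_lifting type_definition_c0

lemma coord_tendsto: "coord x \<longlonglongrightarrow> 0"
  using coord[of x] by simp

instantiation c0 :: real_vector
begin

lift_definition zero_c0 :: c0 is "\<lambda>_. 0" by simp

lift_definition plus_c0 :: "c0 \<Rightarrow> c0 \<Rightarrow> c0" is "\<lambda>x y n. x n + y n"
  by (rule tendsto_add_zero)

lift_definition uminus_c0 :: "c0 \<Rightarrow> c0" is "\<lambda>x n. - x n"
  using tendsto_minus by fastforce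

lift_definition minus_c0 :: "c0 \<Rightarrow> c0 \<Rightarrow> c0" is "\<lambda>x y n. x n - y n"
  using tendsto_diff by fastforce

lift_definition scaleR_c0 :: "real \<Rightarrow> c0 \<Rightarrow> c0" is "\<lambda>r x n. r * x n"
  by (rule tendsto_mult_right_zero)

instance
  by standard (transfer; simp add: fun_eq_iff algebra_simps)+

end

lemma bdd_above_coord: "bdd_above (range (\<lambda>n. \<bar>coord x n\<bar>))"
proof -
  have "Bseq (coord x)"
    using coord_tendsto convergentI convergent_imp_Bseq by blast
  then obtain K where "\<And>n. \<bar>coord x n\<bar> \<le> K"
    unfolding Bseq_def by auto
  then show ?thesis by (intro bdd_aboveI2)
qed

instantiation c0 :: real_normed_vector
begin

definition norm_c0 :: "c0 \<Rightarrow> real"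
  where "norm_c0 x = (SUP n. \<bar>coord x n\<bar>)"

definition dist_c0 :: "c0 \<Rightarrow> c0 \<Rightarrow> real"
  where "dist_c0 x y = norm (x - y)"

definition sgn_c0 :: "c0 \<Rightarrow> c0"
  where "sgn_c0 x = x /\<^sub>R norm x"

definition uniformity_c0 :: "(c0 \<times> c0) filter"
  where "uniformity_c0 = (INF e\<in>{0<..}. principal {(x, y). dist x y < e})"

definition open_c0 :: "c0 set \<Rightarrow> bool"
  where "open_c0 U = (\<forall>x\<in>U. \<forall>\<^sub>F (x', y) in uniformity. x' = x \<longrightarrow> y \<in> U)"

instance
proof
  fix x y :: c0 and a :: real and U :: "c0 set"
  have le: "\<bar>coord z n\<bar> \<le> norm z" for z n
    unfolding norm_c0_def by (rule cSUP_upper[OF _ bdd_above_coord]) simp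
  show "dist x y = norm (x - y)" by (rule dist_c0_def)
  show "sgn x = x /\<^sub>R norm x" by (rule sgn_c0_def)
  show "uniformity = (INF e\<in>{0<..}. principal {(x, y :: c0). dist x y < e})"
    by (rule uniformity_c0_def)
  show "open U = (\<forall>x\<in>U. \<forall>\<^sub>F (x', y) in uniformity. x' = x \<longrightarrow> y \<in> U)"
    by (rule open_c0_def)
  show "norm x = 0 \<longleftrightarrow> x = 0"
  proof
    assume "norm x = 0"
    then have "coord x n = 0" for n using le[of x n] by simp
    then have "coord x = coord 0" by (simp add: fun_eq_iff zero_c0.rep_eq)
    then show "x = 0" by (simp add: coord_inject)
  next
    assume "x = 0"
    then show "norm x = 0" by (simp add: norm_c0_def zero_c0.rep_eq)
  qed
  show "norm (x + y) \<le> norm x + norm y"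
  proof -
    have "\<bar>coord (x + y) n\<bar> \<le> norm x + norm y" for n
      using le[of x n] le[of y n] by (simp add: plus_c0.rep_eq)
    then show ?thesis
      unfolding norm_c0_def[of "x + y"] by (intro cSUP_least) auto
  qed
  show "norm (a *\<^sub>R x) = \<bar>a\<bar> * norm x"
  proof (cases "a = 0")
    case True
    then show ?thesis by (simp add: norm_c0_def zero_c0.rep_eq)
  next
    case False
    have ub: "norm (b *\<^sub>R z) \<le> \<bar>b\<bar> * norm z" for b :: real and z :: c0
      unfolding norm_c0_def[of "b *\<^sub>R z"]
      by (intro cSUP_least) (auto simp: scaleR_c0.rep_eq abs_mult le intro: mult_left_mono)
    have "norm x \<le> \<bar>inverse a\<bar> * norm (a *\<^sub>R x)"
      using ub[of "inverse a" "a *\<^sub>R x"] False by simp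
    then have "\<bar>a\<bar> * norm x \<le> norm (a *\<^sub>R x)"
      using False by (simp add: field_simps)
    with ub[of a x] show ?thesis by simp
  qed
qed

end

lemma abs_coord_le_norm: "\<bar>coord x n\<bar> \<le> norm x"
  unfolding norm_c0_def by (rule cSUP_upper[OF _ bdd_above_coord]) simp

lemma norm_c0_leI: "(\<And>n. \<bar>coord x n\<bar> \<le> K) \<Longrightarrow> norm x \<le> K"
  unfolding norm_c0_def by (intro cSUP_least) auto

instance c0 :: banach
proof
  fix X :: "nat \<Rightarrow> c0"
  assume "Cauchy X"
  have dist_coord: "\<bar>coord (X m) k - coord (X n) k\<bar> \<le> dist (X m) (X n)" for m n k
    using abs_coord_le_norm[of "X m - X n" k] by (simp add: dist_norm minus_c0.rep_eq)
  have "Cauchy (\<lambda>n. coord (X n) k)" for k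
  proof (rule metric_CauchyI)
    fix e :: real
    assume "e > 0"
    then obtain M where M: "\<And>m n. m \<ge> M \<Longrightarrow> n \<ge> M \<Longrightarrow> dist (X m) (X n) < e"
      using metric_CauchyD[OF \<open>Cauchy X\<close> \<open>e > 0\<close>] by blast
    have "dist (coord (X m) k) (coord (X n) k) < e" if "m \<ge> M" "n \<ge> M" for m n
      using M[OF that] dist_coord[of m k n] by (simp add: dist_real_def)
    then show "\<exists>M. \<forall>m\<ge>M. \<forall>n\<ge>M. dist (coord (X m) k) (coord (X n) k) < e"
      by blast
  qed
  then have "\<exists>l. (\<lambda>n. coord (X n) k) \<longlonglongrightarrow> l" for k
    using Cauchy_convergent convergent_def by blast
  then obtain l where l: "\<And>k. (\<lambda>n. coord (X n) k) \<longlonglongrightarrow> l k"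
    by metis
  have unif: "\<exists>M. \<forall>m\<ge>M. \<forall>k. \<bar>coord (X m) k - l k\<bar> \<le> e" if "e > 0" for e
  proof -
    obtain M where M: "\<And>m n. m \<ge> M \<Longrightarrow> n \<ge> M \<Longrightarrow> dist (X m) (X n) < e"
      using metric_CauchyD[OF \<open>Cauchy X\<close> \<open>e > 0\<close>] by blast
    have "\<bar>coord (X m) k - l k\<bar> \<le> e" if "m \<ge> M" for m k
    proof (rule LIMSEQ_le_const2)
      show "(\<lambda>n. \<bar>coord (X m) k - coord (X n) k\<bar>) \<longlonglongrightarrow> \<bar>coord (X m) k - l k\<bar>"
        by (intro tendsto_intros l)
      show "\<exists>N. \<forall>n\<ge>N. \<bar>coord (X m) k - coord (X n) k\<bar> \<le> e"
        using M[OF that] dist_coord[of m k] by (meson le_less_trans less_imp_le)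
    qed
    then show ?thesis by blast
  qed
  have "l \<longlonglongrightarrow> 0"
  proof (rule LIMSEQ_I)
    fix e :: real
    assume "e > 0"
    then obtain M where M: "\<And>k. \<bar>coord (X M) k - l k\<bar> \<le> e / 2"
      using unif[of "e / 2"] by auto
    obtain K where K: "\<And>k. k \<ge> K \<Longrightarrow> \<bar>coord (X M) k\<bar> < e / 2"
      using LIMSEQ_D[OF coord_tendsto[of "X M"], of "e / 2"] \<open>e > 0\<close> by auto
    have "norm (l k - 0) < e" if "k \<ge> K" for k
      using M[of k] K[OF that] unfolding real_norm_def by linarith
    then show "\<exists>no. \<forall>n\<ge>no. norm (l n - 0) < e" by blast
  qed
  then have L: "coord (Abs_c0 l) = l"
    by (simp add: Abs_c0_inverse)
  have "X \<longlonglongrightarrow> Abs_c0 l"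
  proof (rule LIMSEQ_I)
    fix e :: real
    assume "e > 0"
    then obtain M where M: "\<And>m k. m \<ge> M \<Longrightarrow> \<bar>coord (X m) k - l k\<bar> \<le> e / 2"
      using unif[of "e / 2"] by auto
    have "norm (X m - Abs_c0 l) < e" if "m \<ge> M" for m
    proof -
      have "norm (X m - Abs_c0 l) \<le> e / 2"
        by (rule norm_c0_leI) (use M[OF that] in \<open>simp only: minus_c0.rep_eq L\<close>)
      with \<open>e > 0\<close> show ?thesis by simp
    qed
    then show "\<exists>no. \<forall>n\<ge>no. norm (X n - Abs_c0 l) < e" by blast
  qed
  then show "convergent X" by (rule convergentI)
qed

lift_definition unit_c0 :: "nat \<Rightarrow> c0" is "\<lambda>j n. if n = j then 1 else 0"
proof -
  fix j :: nat
  have "\<forall>\<^sub>F n in sequentially. (if n = j then 1 else 0) = (0 :: real)"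
    using eventually_gt_at_top[of j] by eventually_elim simp
  then show "(\<lambda>n. if n = j then 1 else (0 :: real)) \<longlonglongrightarrow> 0"
    by (rule tendsto_eventually)
qed

section \<open>Continuous 3-linear forms\<close>

definition continuous_trilinear_form :: "(c0 \<Rightarrow> c0 \<Rightarrow> c0 \<Rightarrow> real) \<Rightarrow> bool" where
  "continuous_trilinear_form T \<longleftrightarrow>
     (\<forall>y z. linear (\<lambda>x. T x y z)) \<and>
     (\<forall>x z. linear (\<lambda>y. T x y z)) \<and>
     (\<forall>x y. linear (\<lambda>z. T x y z)) \<and>
     continuous_on UNIV (\<lambda>(x, y, z). T x y z)"

text \<open>The supremum below is meaningful for continuous 3-linear forms, for which the set
  is bounded above.\<close>

definition trilinear_norm :: "(c0 \<Rightarrow> c0 \<Rightarrow> c0 \<Rightarrow> real) \<Rightarrow> real" where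
  "trilinear_norm T =
     Sup {\<bar>T z1 z2 z3\<bar> | z1 z2 z3. norm z1 \<le> 1 \<and> norm z2 \<le> 1 \<and> norm z3 \<le> 1}"

section \<open>The generalized Bohnenblust--Hille inequality\<close>

text \<open>Since coordinates start from 0, the indices 1, ..., N of the usual
  formulation become 0, ..., N - 1.\<close>

definition mixed_sum ::
    "real \<Rightarrow> real \<Rightarrow> real \<Rightarrow> (c0 \<Rightarrow> c0 \<Rightarrow> c0 \<Rightarrow> real) \<Rightarrow> nat \<Rightarrow> real" where
  "mixed_sum q1 q2 q3 T N =
     (\<Sum>j1<N. (\<Sum>j2<N. (\<Sum>j3<N.
        \<bar>T (unit_c0 j1) (unit_c0 j2) (unit_c0 j3)\<bar> powr q3) powr (q2 / q3)) powr (q1 / q2))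
      powr (1 / q1)"

definition BH_inequality :: "real \<Rightarrow> real \<Rightarrow> real \<Rightarrow> real \<Rightarrow> bool" where
  "BH_inequality q1 q2 q3 C \<longleftrightarrow>
     (\<forall>T N. continuous_trilinear_form T \<longrightarrow> N \<ge> 1 \<longrightarrow>
        mixed_sum q1 q2 q3 T N \<le> C * trilinear_norm T)"

definition optimal_BH_constant :: "real \<Rightarrow> real \<Rightarrow> real \<Rightarrow> real \<Rightarrow> bool" where
  "optimal_BH_constant q1 q2 q3 C \<longleftrightarrow>
     BH_inequality q1 q2 q3 C \<and> (\<forall>C'. BH_inequality q1 q2 q3 C' \<longrightarrow> C \<le> C')"

end

theory Submission
  imports Defs
begin

text \<open>The reciprocals of the exponents are convex combinations of three corners,
\[ (1/q_1, 1/q_2, 1/q_3) = \theta\,(1, 1/2, 1/2)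
   + (1 - \theta)\,\bigl(\tau\,(3/4, 3/4, 1/2) + (1 - \tau)\,(3/4, 1/2, 3/4)\bigr), \]
so Hoelder's inequality for mixed norms (\<open>mixed_interpolation\<close>) bounds the mixed sum by the
corresponding geometric mean of the mixed sums with exponents $(1,2,2)$, $(4/3,4/3,2)$ and
$(4/3,2,4/3)$.  Their constants are $2$, $2^{3/4}$ and $2^{3/4}$ (\<open>corner_1_2_2\<close>,
\<open>corner_43_43_2\<close>, \<open>corner_43_2_43\<close>), and the geometric mean is $2^{(\theta+3)/4}$.

The corners come from Khinchine's inequality.  If $a_{ijk}$ are the coefficients of a form of norm
at most $M$, then for every choice of signs $\varepsilon$ the matrix
$\sum_k \varepsilon_k a_{ijk}$ belongs to a bilinear form of norm at most $M$, for which
Littlewood's inequalities give the constant $\sqrt 2$; averaging over $\varepsilon$ recovers the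
$\ell_2$ norm in $k$ up to the constant of Khinchine's inequality with the outer exponent.  For the
exponent $4/3$ the value $2^{1/4}$ of that constant, attained by $\varepsilon_1 + \varepsilon_2$,
is essential, and its proof (\<open>khinchine_four_thirds\<close>) is the main part of this theory.  The
sharp inequality for the exponent $1$ is a consequence, because $L_{4/3}$ interpolates between
$L_1$ and $L_2$.

To prove it, divide the Rademacher sum by its largest coefficient, so that it becomes $\pm 1 + Y$,
where $Y$ has coefficients of modulus at most $1$ and variance $w$.  Averaging over the first sign
turns the claim into $E\,h(Y) \ge ((1+w)/2)^{2/3}$, where
$h(y) = |(1+y)/2|^{4/3} + |(1-y)/2|^{4/3}$.  For each range of $w$ there is an explicit minorant of
$h$ whose average is computable: an even polynomial, averaged through the moments of $Y$, plus a
multiple of a cosine, averaged through $E \cos(tY) = \prod_i \cos(t c_i)$.  Equality forces the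
minorant to touch $h$ at $y = 1$ when $w = 1$; elsewhere there is some room.  For $w > 10$ all
coefficients are small compared with the sum, the Rademacher sum is nearly Gaussian, and a minorant
of $|x|^{4/3}$ with two cosines suffices.  The one-variable inequalities are reduced to the
nonnegativity of explicit polynomials on intervals, which is read off from Bernstein coefficients.

The constant cannot be improved because the form \<open>extremal_form\<close> has norm at most $4$ and
sixteen coefficients of modulus $1$ arranged so that its mixed sum is
$4^{1/q_1}\, 2^{1/q_2}\, 2^{1/q_3} = 4 \cdot 2^{(\theta+3)/4}$.\<close>

section \<open>Nonnegative polynomials on intervals\<close>

text \<open>Polynomials are lists of coefficients, lowest degree first, so that the operations below, and with
them the nonnegativity tests, are evaluated by rewriting.\<close>
primrec peval :: "real list \<Rightarrow> real \<Rightarrow> real" where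
  "peval [] x = 0"
| "peval (c # p) x = c + x * peval p x"

fun padd :: "real list \<Rightarrow> real list \<Rightarrow> real list" where
  "padd [] q = q"
| "padd (c # p) [] = c # p"
| "padd (c # p) (d # q) = (c + d) # padd p q"

primrec psmult :: "real \<Rightarrow> real list \<Rightarrow> real list" where
  "psmult a [] = []"
| "psmult a (c # p) = a * c # psmult a p"

primrec plinmult :: "real \<Rightarrow> real \<Rightarrow> real list \<Rightarrow> real list" where
  "plinmult a b [] = []"
| "plinmult a b (c # p) = a * c # padd [b * c] (plinmult a b p)"

primrec pcomp_linear :: "real \<Rightarrow> real \<Rightarrow> real list \<Rightarrow> real list" where
  "pcomp_linear a b [] = []"
| "pcomp_linear a b (c # p) = padd [c] (plinmult a b (pcomp_linear a b p))"

lemma peval_padd [simp]: "peval (padd p q) x = peval p x + peval q x"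
  by (induction p q rule: padd.induct) (auto simp: algebra_simps)

lemma peval_psmult [simp]: "peval (psmult a p) x = a * peval p x"
  by (induction p) (auto simp: algebra_simps)

lemma peval_plinmult [simp]: "peval (plinmult a b p) x = (a + b * x) * peval p x"
  by (induction p) (auto simp: algebra_simps)

lemma peval_pcomp_linear [simp]: "peval (pcomp_linear a b p) x = peval p (a + b * x)"
  by (induction p) (auto simp: algebra_simps)

lemma peval_nonneg: "list_all (\<lambda>c. 0 \<le> c) p \<Longrightarrow> 0 \<le> x \<Longrightarrow> 0 \<le> peval p x"
  by (induction p) auto

text \<open>The first component is $(1+t)^{\deg p}\, p((a+bt)/(1+t))$ as a polynomial in $t$; up to binomial
factors its coefficients are the Bernstein coefficients of $p$ on $[a,b]$.  The second component is
the power $(1+t)^n$, where $n$ is the length of the list, carried along for the recursion.\<close>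
primrec bernstein :: "real \<Rightarrow> real \<Rightarrow> real list \<Rightarrow> real list \<times> real list" where
  "bernstein a b [] = ([], [1])"
| "bernstein a b (c # p) = (case bernstein a b p of (q, h) \<Rightarrow>
     (padd (psmult c h) (plinmult a b q), plinmult 1 1 h))"

lemma peval_bernstein:
  assumes "1 + t \<noteq> 0"
  shows "peval (snd (bernstein a b p)) t = (1 + t) ^ length p"
    and "(1 + t) * peval (fst (bernstein a b p)) t = (1 + t) ^ length p * peval p ((a + b * t) / (1 + t))"
proof (induction p)
  case (Cons c p)
  obtain q h where qh: "bernstein a b p = (q, h)" by fastforce
  show "peval (snd (bernstein a b (c # p))) t = (1 + t) ^ length (c # p)"
    using Cons.IH(1) by (simp add: qh)
  have "(1 + t) * peval (fst (bernstein a b (c # p))) t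
      = (1 + t) * c * (1 + t) ^ length p + (a + b * t) * ((1 + t) * peval q t)"
    using Cons.IH(1) by (simp add: qh algebra_simps)
  also have "(1 + t) * peval q t = (1 + t) ^ length p * peval p ((a + b * t) / (1 + t))"
    using Cons.IH(2) by (simp add: qh)
  also have "(1 + t) * c * (1 + t) ^ length p
      + (a + b * t) * ((1 + t) ^ length p * peval p ((a + b * t) / (1 + t)))
      = (1 + t) ^ length (c # p) * peval (c # p) ((a + b * t) / (1 + t))"
    using assms by (simp add: field_simps)
  finally show "(1 + t) * peval (fst (bernstein a b (c # p))) t
      = (1 + t) ^ length (c # p) * peval (c # p) ((a + b * t) / (1 + t))" .
qed simp_all

lemma isCont_peval: "isCont (peval p) x"
  by (induction p) (auto intro!: continuous_intros)

text \<open>The map $t \mapsto (a+bt)/(1+t)$ takes $[0,\infty)$ onto $[a,b)$, so nonnegative coefficients after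
this substitution are a sufficient test for nonnegativity on the interval.\<close>
definition nonneg_on :: "real \<Rightarrow> real \<Rightarrow> real list \<Rightarrow> bool" where
  "nonneg_on a b p \<longleftrightarrow> a < b \<and> list_all (\<lambda>c. 0 \<le> c) (fst (bernstein a b p))"

definition nonneg_from :: "real \<Rightarrow> real list \<Rightarrow> bool" where
  "nonneg_from a p \<longleftrightarrow> list_all (\<lambda>c. 0 \<le> c) (pcomp_linear a 1 p)"

lemma nonneg_onD:
  assumes "nonneg_on a b p" and "a \<le> x" and "x \<le> b"
  shows "0 \<le> peval p x"
proof -
  have ab: "a < b" and pos: "list_all (\<lambda>c. 0 \<le> c) (fst (bernstein a b p))"
    using assms(1) by (auto simp: nonneg_on_def)
  have inside: "0 \<le> peval p y" if "a \<le> y" "y < b" for y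
  proof -
    define t where "t = (y - a) / (b - y)"
    have t: "0 \<le> t" using that by (simp add: t_def)
    have "1 + t = (b - a) / (b - y)" "a + b * t = y * ((b - a) / (b - y))"
      using that by (simp_all add: t_def field_simps)
    then have y: "(a + b * t) / (1 + t) = y"
      using that by simp
    have "0 \<le> (1 + t) ^ length p * peval p y"
      using peval_bernstein(2)[of t a b p] peval_nonneg[OF pos t] t unfolding y
      by (metis add_nonneg_nonneg add_nonneg_eq_0_iff mult_nonneg_nonneg zero_le_one zero_neq_one)
    moreover have "0 < (1 + t) ^ length p" using t by simp
    ultimately show ?thesis by (simp add: zero_le_mult_iff)
  qed
  show ?thesis
  proof (cases "x < b")
    case True
    then show ?thesis using inside assms(2) by simp
  next
    case False
    then have x: "x = b" using assms(3) by simp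
    have "(peval p \<longlongrightarrow> peval p b) (at_left b)"
      using isCont_peval[of b p] by (simp add: isCont_def filterlim_at_split)
    moreover have "\<forall>\<^sub>F y in at_left b. 0 \<le> peval p y"
      unfolding eventually_at_left[OF ab] using inside ab by (intro exI[of _ a]) auto
    ultimately have "0 \<le> peval p b"
      by (rule tendsto_lowerbound) auto
    then show ?thesis by (simp add: x)
  qed
qed

lemma nonneg_fromD: "nonneg_from a p \<Longrightarrow> a \<le> x \<Longrightarrow> 0 \<le> peval p x"
  using peval_nonneg[of "pcomp_linear a 1 p" "x - a"] by (simp add: nonneg_from_def)

section \<open>Polynomial bounds for the power 4/3 and for the cosine\<close>

text \<open>With $x = (rs)^3$ both inequalities are polynomial in $s$.  The left-hand sides are the Taylor
polynomials of $u \mapsto u^{4/3}$ of degree $3$ and $1$ at $u = 1$, so the differences have a zero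
of order $4$ and $2$ at $s = 1$, and the cofactors have positive coefficients.\<close>
lemma powr_tangent_cubic:
  fixes r x :: real
  assumes "0 < r" and "0 \<le> x"
  shows "r ^ 4 * peval [- 5 / 81, 20 / 27, 10 / 27, - 4 / 81] (x / r ^ 3) \<le> x powr (4 / 3)"
    and "r ^ 4 * peval [- 1 / 3, 4 / 3] (x / r ^ 3) \<le> x powr (4 / 3)"
proof -
  define s where "s = (x / r ^ 3) powr (1 / 3)"
  have s: "0 \<le> s" by (simp add: s_def)
  have s3: "x / r ^ 3 = s ^ 3"
    using assms by (cases "x = 0") (simp_all add: s_def powr_powr flip: powr_numeral)
  have "x powr (4 / 3) = (r ^ 3 * s ^ 3) powr (4 / 3)"
    using assms by (simp flip: s3)
  also have "\<dots> = (r * s) ^ 4"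
    using assms s by (cases "s = 0")
      (simp_all add: powr_powr powr_mult power_mult_distrib flip: powr_numeral)
  finally have x: "x powr (4 / 3) = r ^ 4 * s ^ 4" by (simp add: power_mult_distrib)
  have "s ^ 4 - peval [- 5 / 81, 20 / 27, 10 / 27, - 4 / 81] (s ^ 3)
      = (s - 1) ^ 4 * (4 * s ^ 5 + 16 * s ^ 4 + 40 * s ^ 3 + 50 * s ^ 2 + 20 * s + 5) / 81"
    by (simp add: field_simps eval_nat_numeral)
  also have "\<dots> \<ge> 0" using s by simp
  finally have "peval [- 5 / 81, 20 / 27, 10 / 27, - 4 / 81] (s ^ 3) \<le> s ^ 4" by simp
  then show "r ^ 4 * peval [- 5 / 81, 20 / 27, 10 / 27, - 4 / 81] (x / r ^ 3) \<le> x powr (4 / 3)"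
    unfolding x s3 using assms by (intro mult_left_mono) auto
  have "s ^ 4 - peval [- 1 / 3, 4 / 3] (s ^ 3) = (s - 1) ^ 2 * (3 * s ^ 2 + 2 * s + 1) / 3"
    by (simp add: field_simps eval_nat_numeral)
  also have "\<dots> \<ge> 0" using s by simp
  finally have "peval [- 1 / 3, 4 / 3] (s ^ 3) \<le> s ^ 4" by simp
  then show "r ^ 4 * peval [- 1 / 3, 4 / 3] (x / r ^ 3) \<le> x powr (4 / 3)"
    unfolding x s3 using assms by (intro mult_left_mono) auto
qed

text \<open>Near $0$ the power $4/3$ dominates every multiple of the square; this replaces the Taylor polynomials
where the argument may vanish.\<close>
lemma powr_ge_square:
  fixes r x :: real
  assumes "0 < r" and "0 \<le> x" and "x \<le> r ^ 3"
  shows "x\<^sup>2 / r\<^sup>2 \<le> x powr (4 / 3)"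
proof (cases "x = 0")
  case False
  then have x: "0 < x" using assms by simp
  have "x powr (2 / 3) \<le> (r ^ 3) powr (2 / 3)"
    using assms by (intro powr_mono2) auto
  also have "\<dots> = r\<^sup>2"
    using assms by (simp add: powr_powr flip: powr_numeral)
  finally have "x powr (4 / 3) * x powr (2 / 3) \<le> x powr (4 / 3) * r\<^sup>2"
    by (intro mult_left_mono) auto
  moreover have "x powr (4 / 3) * x powr (2 / 3) = x\<^sup>2"
    using x by (simp flip: powr_add)
  ultimately show ?thesis using assms by (simp add: field_simps)
qed simp

definition taylor_cubic :: "real \<Rightarrow> real \<Rightarrow> real \<Rightarrow> real list" where
  "taylor_cubic r a b = psmult (r ^ 4) (pcomp_linear (a / r ^ 3) (b / r ^ 3) [- 5 / 81, 20 / 27, 10 / 27, - 4 / 81])"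

definition tangent_line :: "real \<Rightarrow> real \<Rightarrow> real \<Rightarrow> real list" where
  "tangent_line r a b = psmult (r ^ 4) (pcomp_linear (a / r ^ 3) (b / r ^ 3) [- 1 / 3, 4 / 3])"

definition power_square :: "real \<Rightarrow> real \<Rightarrow> real \<Rightarrow> real list" where
  "power_square r a b = psmult (1 / r\<^sup>2) (pcomp_linear a b [0, 0, 1])"

lemma taylor_cubic_le: "0 < r \<Longrightarrow> 0 \<le> a + b * y \<Longrightarrow> peval (taylor_cubic r a b) y \<le> \<bar>a + b * y\<bar> powr (4 / 3)"
  using powr_tangent_cubic(1)[of r "a + b * y"]
  unfolding taylor_cubic_def peval_psmult peval_pcomp_linear by (simp add: add_divide_distrib del: peval.simps)

lemma tangent_line_le: "0 < r \<Longrightarrow> 0 \<le> a + b * y \<Longrightarrow> peval (tangent_line r a b) y \<le> \<bar>a + b * y\<bar> powr (4 / 3)"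
  using powr_tangent_cubic(2)[of r "a + b * y"]
  unfolding tangent_line_def peval_psmult peval_pcomp_linear by (simp add: add_divide_distrib del: peval.simps)

lemma power_square_le: "0 < r \<Longrightarrow> \<bar>a + b * y\<bar> \<le> r ^ 3 \<Longrightarrow> peval (power_square r a b) y \<le> \<bar>a + b * y\<bar> powr (4 / 3)"
  using powr_ge_square[of r "\<bar>a + b * y\<bar>"]
  unfolding power_square_def peval_psmult peval_pcomp_linear by (simp add: power2_eq_square)

definition "cos2 = [1, 0, - 1 / 2 :: real]"
definition "cos4 = [1, 0, - 1 / 2, 0, 1 / 24 :: real]"
definition "cos6 = [1, 0, - 1 / 2, 0, 1 / 24, 0, - 1 / 720 :: real]"
definition "cos8 = [1, 0, - 1 / 2, 0, 1 / 24, 0, - 1 / 720, 0, 1 / 40320 :: real]"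
definition "cos10 = [1, 0, - 1 / 2, 0, 1 / 24, 0, - 1 / 720, 0, 1 / 40320, 0, - 1 / 3628800 :: real]"

lemmas cos_taylor_defs = cos2_def cos4_def cos6_def cos8_def cos10_def

text \<open>The Lagrange remainder of the cosine after an even number $n$ of terms is $\pm \cos t \cdot x^n/n!$,
which replacing $\cos t$ by $1$ can only move in one direction.\<close>
lemma cos_taylor:
  fixes x :: real
  shows "peval cos2 x \<le> cos x" and "cos x \<le> peval cos4 x" and "peval cos6 x \<le> cos x"
    and "cos x \<le> peval cos8 x" and "peval cos10 x \<le> cos x"
proof -
  have step: "\<exists>t. cos x = (\<Sum>m<n. cos_coeff m * x ^ m) + cos (t + 1 / 2 * real n * pi) / fact n * x ^ n" for n
    using Maclaurin_cos_expansion[of x n] by blast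
  have mono: "cos t * a \<le> a" "- a \<le> - (cos t * a)" if "0 \<le> a" for t a :: real
    using that mult_right_mono[OF cos_le_one[of t] that] by simp_all
  have shift: "cos (t + pi) = - cos t" "cos (t + 2 * pi) = cos t" "cos (t + 3 * pi) = - cos t"
    "cos (t + 4 * pi) = cos t" "cos (t + 5 * pi) = - cos t" for t :: real
    using cos_periodic[of t] cos_periodic[of "t + 2 * pi"] cos_periodic_pi[of "t + 2 * pi"]
      cos_periodic_pi[of "t + 4 * pi"] cos_periodic_pi[of t]
    by (simp_all add: algebra_simps)
  have sums: "sum f {..<2} = f 0 + f 1" "sum f {..<4} = f 0 + f 1 + f 2 + f 3"
    "sum f {..<6} = f 0 + f 1 + f 2 + f 3 + f 4 + f 5"
    "sum f {..<8} = f 0 + f 1 + f 2 + f 3 + f 4 + f 5 + f 6 + f 7"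
    "sum f {..<10} = f 0 + f 1 + f 2 + f 3 + f 4 + f 5 + f 6 + f 7 + f 8 + f 9"
    for f :: "nat \<Rightarrow> real"
    by (simp_all add: eval_nat_numeral)
  have coeffs: "cos_coeff 0 = 1" "cos_coeff (Suc 0) = 0" "cos_coeff 2 = - 1 / 2" "cos_coeff 3 = 0"
    "cos_coeff 4 = 1 / 24" "cos_coeff 5 = 0" "cos_coeff 6 = - 1 / 720" "cos_coeff 7 = 0"
    "cos_coeff 8 = 1 / 40320" "cos_coeff 9 = 0"
    by (simp_all add: cos_coeff_def fact_numeral)
  have facts: "fact 2 = (2 :: real)" "fact 4 = (24 :: real)" "fact 6 = (720 :: real)"
    "fact 8 = (40320 :: real)" "fact 10 = (3628800 :: real)"
    by (simp_all add: fact_numeral)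
  have pows: "peval cos2 x = 1 - x ^ 2 / 2" "peval cos4 x = 1 - x ^ 2 / 2 + x ^ 4 / 24"
    "peval cos6 x = 1 - x ^ 2 / 2 + x ^ 4 / 24 - x ^ 6 / 720"
    "peval cos8 x = 1 - x ^ 2 / 2 + x ^ 4 / 24 - x ^ 6 / 720 + x ^ 8 / 40320"
    "peval cos10 x = 1 - x ^ 2 / 2 + x ^ 4 / 24 - x ^ 6 / 720 + x ^ 8 / 40320 - x ^ 10 / 3628800"
    by (simp_all add: cos_taylor_defs eval_nat_numeral field_simps)
  note simps = sums coeffs facts pows shift
  obtain t where "cos x = (\<Sum>m<2. cos_coeff m * x ^ m) + cos (t + 1 / 2 * real 2 * pi) / fact 2 * x ^ 2"
    using step by blast
  with mono(2)[of "x ^ 2 / 2" t] show "peval cos2 x \<le> cos x"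
    by (simp add: simps mult.commute[of pi])
  obtain t where "cos x = (\<Sum>m<4. cos_coeff m * x ^ m) + cos (t + 1 / 2 * real 4 * pi) / fact 4 * x ^ 4"
    using step by blast
  with mono(1)[of "x ^ 4 / 24" t] show "cos x \<le> peval cos4 x"
    by (simp add: simps mult.commute[of pi])
  obtain t where "cos x = (\<Sum>m<6. cos_coeff m * x ^ m) + cos (t + 1 / 2 * real 6 * pi) / fact 6 * x ^ 6"
    using step by blast
  with mono(2)[of "x ^ 6 / 720" t] show "peval cos6 x \<le> cos x"
    by (simp add: simps mult.commute[of pi])
  obtain t where "cos x = (\<Sum>m<8. cos_coeff m * x ^ m) + cos (t + 1 / 2 * real 8 * pi) / fact 8 * x ^ 8"
    using step by blast
  with mono(1)[of "x ^ 8 / 40320" t] show "cos x \<le> peval cos8 x"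
    by (simp add: simps mult.commute[of pi])
  obtain t where "cos x = (\<Sum>m<10. cos_coeff m * x ^ m) + cos (t + 1 / 2 * real 10 * pi) / fact 10 * x ^ 10"
    using step by blast
  with mono(2)[of "x ^ 10 / 3628800" t] show "peval cos10 x \<le> cos x"
    by (simp add: simps mult.commute[of pi])
qed

text \<open>The Taylor polynomials have definite signs at $1.57075$ and $1.57085$, which encloses the first zero
$\pi/2$ of the cosine.\<close>
lemma pi_near: "\<bar>pi - 22 / 7\<bar> \<le> 1 / 700"
proof -
  have "0 < cos (157075 / 100000 :: real)"
    using cos_taylor(5)[of "157075 / 100000"] by (simp add: cos10_def)
  then have "157075 / 100000 < pi / 2"
    using cos_ge_zero[of "157075 / 100000 - pi"] pi_ge_two
    by (cases "157075 / 100000 < pi / 2") (auto simp: cos_diff)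
  moreover have "cos (157085 / 100000 :: real) < 0"
    using cos_taylor(4)[of "157085 / 100000"] by (simp add: cos8_def)
  then have "pi / 2 < 157085 / 100000"
    using cos_ge_zero[of "157085 / 100000"] by (cases "pi / 2 < 157085 / 100000") auto
  ultimately show ?thesis unfolding abs_le_iff by linarith
qed

text \<open>Expanding the cosine around $k\pi$ keeps the Taylor polynomials short for large arguments.  The
rational centre $22k/7$ costs at most $k/700$, since the cosine is $1$-Lipschitz.\<close>
lemma cos_near_multiple_of_pi:
  fixes z :: real
  shows "\<bar>cos z - (- 1) ^ k * cos (z - real k * (22 / 7))\<bar> \<le> real k / 700"
proof -
  have lip: "\<bar>cos a - cos b\<bar> \<le> \<bar>a - b\<bar>" for a b :: real
  proof -
    have "\<bar>cos a - cos b\<bar> = 2 * (\<bar>sin ((a + b) / 2)\<bar> * \<bar>sin ((b - a) / 2)\<bar>)"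
      by (simp add: cos_diff_cos abs_mult)
    also have "\<dots> \<le> 2 * (1 * \<bar>(b - a) / 2\<bar>)"
      by (intro mult_left_mono mult_mono abs_sin_x_le_abs_x) auto
    finally show ?thesis by simp
  qed
  have "cos z = (- 1) ^ k * cos (z - real k * pi)"
  proof (induction k)
    case (Suc k)
    have "cos (z - real (Suc k) * pi) = - cos (z - real k * pi)"
      using cos_minus_pi[of "z - real k * pi"] by (simp add: algebra_simps)
    with Suc show ?case by simp
  qed simp
  then have "\<bar>cos z - (- 1) ^ k * cos (z - real k * (22 / 7))\<bar>
      = \<bar>cos (z - real k * pi) - cos (z - real k * (22 / 7))\<bar>"
    by (cases "even k") auto
  also have "\<dots> \<le> \<bar>(z - real k * pi) - (z - real k * (22 / 7))\<bar>"
    by (rule lip)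
  also have "\<dots> = \<bar>real k * (22 / 7 - pi)\<bar>"
    by (simp add: algebra_simps)
  also have "\<dots> = real k * \<bar>pi - 22 / 7\<bar>"
    by (simp add: abs_mult abs_minus_commute)
  also have "\<dots> \<le> real k * (1 / 700)"
    by (intro mult_left_mono pi_near) auto
  finally show ?thesis by simp
qed

section \<open>Minorants of the two-point function\<close>

text \<open>Twice the average of $|(y \pm 1)/2|^{4/3}$ over the sign, scaled to be $1$ at the extremal point
$y = 1$.\<close>
definition two_point :: "real \<Rightarrow> real" where
  "two_point y = \<bar>(1 + y) / 2\<bar> powr (4 / 3) + \<bar>(1 - y) / 2\<bar> powr (4 / 3)"

lemma two_point_geI:
  assumes "0 \<le> peval (padd (padd p q) (psmult (- 1) l)) y"
    and "peval p y \<le> \<bar>1 / 2 + 1 / 2 * y\<bar> powr (4 / 3)"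
    and "peval q y \<le> \<bar>1 / 2 + - 1 / 2 * y\<bar> powr (4 / 3)"
  shows "peval l y \<le> two_point y"
  using assms by (simp add: two_point_def add_divide_distrib diff_divide_distrib)

text \<open>The next four lemmas are the ways in which a polynomial is compared with \<open>two_point\<close> on an
interval: Taylor polynomials for both powers on either side of $y = 1$, the square for the second
power close to $y = 1$, and an affine bound for the second power on an unbounded interval.\<close>
lemma two_point_ge_inner:
  assumes "0 \<le> a" "b \<le> 1" "a \<le> y" "y \<le> b" "0 < r" "0 < s"
    and "nonneg_on a b (padd (padd (taylor_cubic r (1 / 2) (1 / 2)) (taylor_cubic s (1 / 2) (- 1 / 2))) (psmult (- 1) l))"
  shows "peval l y \<le> two_point y"
  by (rule two_point_geI[OF nonneg_onD[OF assms(7,3,4)]])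
    (intro taylor_cubic_le; use assms in linarith)+

lemma two_point_ge_square:
  assumes "0 \<le> a" "a \<le> y" "y \<le> b" "0 < r" "0 < s" "1 - a \<le> 2 * s ^ 3" "b - 1 \<le> 2 * s ^ 3"
    and "nonneg_on a b (padd (padd (taylor_cubic r (1 / 2) (1 / 2)) (power_square s (1 / 2) (- 1 / 2))) (psmult (- 1) l))"
  shows "peval l y \<le> two_point y"
  by (rule two_point_geI[OF nonneg_onD[OF assms(8,2,3)]])
    (intro taylor_cubic_le power_square_le; use assms in linarith)+

lemma two_point_ge_outer:
  assumes "1 \<le> a" "a \<le> y" "y \<le> b" "0 < r" "0 < s"
    and "nonneg_on a b (padd (padd (taylor_cubic r (1 / 2) (1 / 2)) (taylor_cubic s (- 1 / 2) (1 / 2))) (psmult (- 1) l))"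
  shows "peval l y \<le> two_point y"
proof (rule two_point_geI[OF nonneg_onD[OF assms(6,2,3)]])
  show "peval (taylor_cubic s (- 1 / 2) (1 / 2)) y \<le> \<bar>1 / 2 + - 1 / 2 * y\<bar> powr (4 / 3)"
    using taylor_cubic_le[of s "- 1 / 2" "1 / 2" y] assms by (simp add: abs_minus_commute)
qed (intro taylor_cubic_le; use assms in linarith)+

lemma two_point_ge_tail:
  assumes "1 \<le> a" "a \<le> y" "0 < r" "0 < s"
    and "nonneg_from a (padd (padd (taylor_cubic r (1 / 2) (1 / 2)) (tangent_line s (- 1 / 2) (1 / 2))) (psmult (- 1) l))"
  shows "peval l y \<le> two_point y"
proof (rule two_point_geI[OF nonneg_fromD[OF assms(5,2)]])
  show "peval (tangent_line s (- 1 / 2) (1 / 2)) y \<le> \<bar>1 / 2 + - 1 / 2 * y\<bar> powr (4 / 3)"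
    using tangent_line_le[of s "- 1 / 2" "1 / 2" y] assms by (simp add: abs_minus_commute)
qed (intro taylor_cubic_le; use assms in linarith)+

text \<open>Taylor bounds of $\cos(ty)$ around the rational substitute $22k/7$ of $k\pi$, corrected by the error
of that substitution.\<close>
definition cos_above :: "nat \<Rightarrow> real \<Rightarrow> real list \<Rightarrow> real list" where
  "cos_above k t p = padd (psmult ((- 1) ^ k) (pcomp_linear (- (real k * (22 / 7))) t p)) [real k / 700]"

definition cos_below :: "nat \<Rightarrow> real \<Rightarrow> real list \<Rightarrow> real list" where
  "cos_below k t p = padd (psmult ((- 1) ^ k) (pcomp_linear (- (real k * (22 / 7))) t p)) [- real k / 700]"

lemma cos_le_above:
  shows "even k \<Longrightarrow> p \<in> {cos4, cos8} \<Longrightarrow> cos (t * y) \<le> peval (cos_above k t p) y"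
    and "odd k \<Longrightarrow> p \<in> {cos2, cos6, cos10} \<Longrightarrow> cos (t * y) \<le> peval (cos_above k t p) y"
proof -
  define z where "z = t * y - real k * (22 / 7)"
  have "cos (t * y) \<le> (- 1) ^ k * cos z + real k / 700"
    using cos_near_multiple_of_pi[of "t * y" k] unfolding z_def[symmetric] abs_le_iff by linarith
  moreover have "peval (cos_above k t p) y = (- 1) ^ k * peval p z + real k / 700"
    unfolding cos_above_def peval_padd peval_psmult peval_pcomp_linear by (simp add: z_def)
  ultimately show "even k \<Longrightarrow> p \<in> {cos4, cos8} \<Longrightarrow> cos (t * y) \<le> peval (cos_above k t p) y"
    and "odd k \<Longrightarrow> p \<in> {cos2, cos6, cos10} \<Longrightarrow> cos (t * y) \<le> peval (cos_above k t p) y"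
    using cos_taylor[of z] by auto
qed

lemma cos_ge_below:
  shows "even k \<Longrightarrow> p \<in> {cos2, cos6, cos10} \<Longrightarrow> peval (cos_below k t p) y \<le> cos (t * y)"
    and "odd k \<Longrightarrow> p \<in> {cos4, cos8} \<Longrightarrow> peval (cos_below k t p) y \<le> cos (t * y)"
proof -
  define z where "z = t * y - real k * (22 / 7)"
  have "(- 1) ^ k * cos z - real k / 700 \<le> cos (t * y)"
    using cos_near_multiple_of_pi[of "t * y" k] unfolding z_def[symmetric] abs_le_iff by linarith
  moreover have "peval (cos_below k t p) y = (- 1) ^ k * peval p z - real k / 700"
    unfolding cos_below_def peval_padd peval_psmult peval_pcomp_linear by (simp add: z_def)
  ultimately show "even k \<Longrightarrow> p \<in> {cos2, cos6, cos10} \<Longrightarrow> peval (cos_below k t p) y \<le> cos (t * y)"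
    and "odd k \<Longrightarrow> p \<in> {cos4, cos8} \<Longrightarrow> peval (cos_below k t p) y \<le> cos (t * y)"
    using cos_taylor[of z] by auto
qed

lemmas cert_simps = nonneg_on_def nonneg_from_def taylor_cubic_def tangent_line_def power_square_def
  cos_above_def cos_below_def cos_taylor_defs eval_nat_numeral

text \<open>The polynomial $(2+y^2)/3 + (y^2-1)^2\,(k_0 - k_1 y^2)$ with $k_0 = 3/250$ and $k_1 = 87/50000$.
In the variable $y^2$ its first summand is the tangent of \<open>two_point\<close> at $y = 1$, where the two
functions have to agree because the sum of two equal coefficients is extremal.  The tangent alone
overtakes \<open>two_point\<close> for large $y$; the second summand repairs this, and its average stays
nonnegative as long as $w \le 6/5$.\<close>
definition "low_poly = [509 / 750, 0, 46139 / 150000, 0, 387 / 25000, 0, - 87 / 50000 :: real]"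

lemma two_point_ge_low_poly:
  fixes y :: real
  assumes "0 \<le> y"
  shows "peval low_poly y \<le> two_point y"
proof -
  consider "y \<le> 7 / 8"
    | "7 / 8 \<le> y" "y \<le> 1"
    | "1 \<le> y" "y \<le> 2"
    | "2 \<le> y" "y \<le> 5 / 2"
    | "5 / 2 \<le> y" "y \<le> 3"
    | "3 \<le> y"
    by linarith
  then show ?thesis
  proof cases
    case 1
    show ?thesis
      by (rule two_point_ge_inner[where a = "0" and b = "7 / 8" and r = "5 / 6" and s = "2 / 3"])
        (use assms 1 in \<open>auto simp: cert_simps low_poly_def\<close>)
  next
    case 2
    show ?thesis
      by (rule two_point_ge_square[where a = "7 / 8" and b = "1" and r = "1" and s = "2 / 5"])
        (use assms 2 in \<open>auto simp: cert_simps low_poly_def\<close>)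
  next
    case 3
    show ?thesis
      by (rule two_point_ge_square[where a = "1" and b = "2" and r = "1" and s = "4 / 5"])
        (use assms 3 in \<open>auto simp: cert_simps low_poly_def\<close>)
  next
    case 4
    show ?thesis
      by (rule two_point_ge_outer[where a = "2" and b = "5 / 2" and r = "5 / 4" and s = "4 / 5"])
        (use assms 4 in \<open>auto simp: cert_simps low_poly_def\<close>)
  next
    case 5
    show ?thesis
      by (rule two_point_ge_outer[where a = "5 / 2" and b = "3" and r = "5 / 4" and s = "1"])
        (use assms 5 in \<open>auto simp: cert_simps low_poly_def\<close>)
  next
    case 6
    show ?thesis
      by (rule two_point_ge_tail[where a = "3" and r = "4 / 3" and s = "1"])
        (use assms 6 in \<open>auto simp: cert_simps low_poly_def\<close>)
  qed
qed

text \<open>From here on the coefficients are found numerically: among the functions of the given shape below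
\<open>two_point\<close> they nearly maximize the smallest ratio of the average to $((1+w)/2)^{2/3}$ in the
range of $w$ for which they are used.  This one serves $6/5 \le w \le 8/5$.\<close>
definition "mid_poly = [1901 / 2500, 0, 2071 / 10000, 0, 1637 / 50000, 0, - 2449 / 1000000 :: real]"

lemma two_point_ge_mid_poly:
  fixes y :: real
  assumes "0 \<le> y"
  shows "peval mid_poly y \<le> two_point y"
proof -
  consider "y \<le> 7 / 8"
    | "7 / 8 \<le> y" "y \<le> 1"
    | "1 \<le> y" "y \<le> 19 / 8"
    | "19 / 8 \<le> y" "y \<le> 23 / 8"
    | "23 / 8 \<le> y"
    by linarith
  then show ?thesis
  proof cases
    case 1
    show ?thesis
      by (rule two_point_ge_inner[where a = "0" and b = "7 / 8" and r = "5 / 6" and s = "2 / 3"])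
        (use assms 1 in \<open>auto simp: cert_simps mid_poly_def\<close>)
  next
    case 2
    show ?thesis
      by (rule two_point_ge_inner[where a = "7 / 8" and b = "1" and r = "1" and s = "1 / 3"])
        (use assms 2 in \<open>auto simp: cert_simps mid_poly_def\<close>)
  next
    case 3
    show ?thesis
      by (rule two_point_ge_square[where a = "1" and b = "19 / 8" and r = "7 / 6" and s = "9 / 10"])
        (use assms 3 in \<open>auto simp: cert_simps mid_poly_def\<close>)
  next
    case 4
    show ?thesis
      by (rule two_point_ge_outer[where a = "19 / 8" and b = "23 / 8" and r = "5 / 4" and s = "1"])
        (use assms 4 in \<open>auto simp: cert_simps mid_poly_def\<close>)
  next
    case 5
    show ?thesis
      by (rule two_point_ge_tail[where a = "23 / 8" and r = "4 / 3" and s = "1"])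
        (use assms 5 in \<open>auto simp: cert_simps mid_poly_def\<close>)
  qed
qed

text \<open>For $8/5 \le w \le 12/5$, if some coefficient besides the first one is close to $1$; the fourth
moment is then well below its Gaussian value, and a quartic suffices.\<close>
definition "spiked_poly = [607 / 1000, 0, 801 / 2000, 0, - 43 / 5000 :: real]"

lemma two_point_ge_spiked_poly:
  fixes y :: real
  assumes "0 \<le> y"
  shows "peval spiked_poly y \<le> two_point y"
proof -
  consider "y \<le> 1"
    | "1 \<le> y" "y \<le> 9 / 8"
    | "9 / 8 \<le> y" "y \<le> 5 / 2"
    | "5 / 2 \<le> y" "y \<le> 3"
    | "3 \<le> y"
    by linarith
  then show ?thesis
  proof cases
    case 1
    show ?thesis
      by (rule two_point_ge_square[where a = "0" and b = "1" and r = "7 / 8" and s = "4 / 5"])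
        (use assms 1 in \<open>auto simp: cert_simps spiked_poly_def\<close>)
  next
    case 2
    show ?thesis
      by (rule two_point_ge_outer[where a = "1" and b = "9 / 8" and r = "1" and s = "1 / 3"])
        (use assms 2 in \<open>auto simp: cert_simps spiked_poly_def\<close>)
  next
    case 3
    show ?thesis
      by (rule two_point_ge_outer[where a = "9 / 8" and b = "5 / 2" and r = "6 / 5" and s = "2 / 3"])
        (use assms 3 in \<open>auto simp: cert_simps spiked_poly_def\<close>)
  next
    case 4
    show ?thesis
      by (rule two_point_ge_outer[where a = "5 / 2" and b = "3" and r = "5 / 4" and s = "1"])
        (use assms 4 in \<open>auto simp: cert_simps spiked_poly_def\<close>)
  next
    case 5
    show ?thesis
      by (rule two_point_ge_tail[where a = "3" and r = "4 / 3" and s = "1"])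
        (use assms 5 in \<open>auto simp: cert_simps spiked_poly_def\<close>)
  qed
qed

text \<open>For $8/5 \le w \le 12/5$, if the other coefficients are at most $22/25$.  The cosine enters with a
positive sign, for which it is enough that its average is nonnegative.\<close>
definition "flat_poly = [653 / 1000, 0, 751 / 2000, 0, - 37 / 5000 :: real]"

lemma two_point_ge_flat_poly:
  fixes y :: real
  assumes "0 \<le> y"
  shows "peval flat_poly y + 57 / 500 * cos (16 / 9 * y) \<le> two_point y"
proof -
  consider "y \<le> 7 / 8"
    | "7 / 8 \<le> y" "y \<le> 1"
    | "1 \<le> y" "y \<le> 19 / 8"
    | "19 / 8 \<le> y" "y \<le> 27 / 8"
    | "27 / 8 \<le> y"
    by linarith
  then show ?thesis
  proof cases
    case 1
    have "peval (padd flat_poly (psmult (57 / 500) (cos_above 0 (16 / 9) cos8))) y \<le> two_point y"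
      by (rule two_point_ge_inner[where a = "0" and b = "7 / 8" and r = "5 / 6" and s = "2 / 3"])
        (use assms 1 in \<open>auto simp: cert_simps flat_poly_def\<close>)
    moreover have "cos (16 / 9 * y) \<le> peval (cos_above 0 (16 / 9) cos8) y"
      by (rule cos_le_above(1)) auto
    ultimately show ?thesis unfolding peval_padd peval_psmult by linarith
  next
    case 2
    have "peval (padd flat_poly (psmult (57 / 500) (cos_above 1 (16 / 9) cos6))) y \<le> two_point y"
      by (rule two_point_ge_inner[where a = "7 / 8" and b = "1" and r = "1" and s = "1 / 3"])
        (use assms 2 in \<open>auto simp: cert_simps flat_poly_def\<close>)
    moreover have "cos (16 / 9 * y) \<le> peval (cos_above 1 (16 / 9) cos6) y"
      by (rule cos_le_above(2)) auto
    ultimately show ?thesis unfolding peval_padd peval_psmult by linarith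
  next
    case 3
    have "peval (padd flat_poly (psmult (57 / 500) (cos_above 1 (16 / 9) cos6))) y \<le> two_point y"
      by (rule two_point_ge_square[where a = "1" and b = "19 / 8" and r = "7 / 6" and s = "9 / 10"])
        (use assms 3 in \<open>auto simp: cert_simps flat_poly_def\<close>)
    moreover have "cos (16 / 9 * y) \<le> peval (cos_above 1 (16 / 9) cos6) y"
      by (rule cos_le_above(2)) auto
    ultimately show ?thesis unfolding peval_padd peval_psmult by linarith
  next
    case 4
    have "peval (padd flat_poly (psmult (57 / 500) (cos_above 2 (16 / 9) cos8))) y \<le> two_point y"
      by (rule two_point_ge_outer[where a = "19 / 8" and b = "27 / 8" and r = "4 / 3" and s = "1"])
        (use assms 4 in \<open>auto simp: cert_simps flat_poly_def\<close>)
    moreover have "cos (16 / 9 * y) \<le> peval (cos_above 2 (16 / 9) cos8) y"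
      by (rule cos_le_above(1)) auto
    ultimately show ?thesis unfolding peval_padd peval_psmult by linarith
  next
    case 5
    have "peval (padd flat_poly (psmult (57 / 500) [1])) y \<le> two_point y"
      by (rule two_point_ge_tail[where a = "27 / 8" and r = "4 / 3" and s = "9 / 8"])
        (use assms 5 in \<open>auto simp: cert_simps flat_poly_def\<close>)
    moreover have "cos (16 / 9 * y) \<le> peval [1] y"
      by simp
    ultimately show ?thesis unfolding peval_padd peval_psmult by linarith
  qed
qed

text \<open>For $12/5 \le w \le 10$.  The cosine enters with a negative sign, and its average is bounded by the
Gaussian value $e^{-w/2}$.\<close>
definition "gauss_poly = [111 / 125, 0, 2713 / 10000, 0, - 69 / 50000 :: real]"

lemma two_point_ge_gauss_poly:
  fixes y :: real
  assumes "0 \<le> y"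
  shows "peval gauss_poly y - 297 / 1000 * cos (1 * y) \<le> two_point y"
proof -
  consider "y \<le> 1"
    | "1 \<le> y" "y \<le> 5 / 4"
    | "5 / 4 \<le> y" "y \<le> 7 / 2"
    | "7 / 2 \<le> y" "y \<le> 59 / 8"
    | "59 / 8 \<le> y" "y \<le> 91 / 8"
    | "91 / 8 \<le> y"
    by linarith
  then show ?thesis
  proof cases
    case 1
    have "peval (padd gauss_poly (psmult (- 297 / 1000) (cos_below 0 1 cos6))) y \<le> two_point y"
      by (rule two_point_ge_square[where a = "0" and b = "1" and r = "7 / 8" and s = "4 / 5"])
        (use assms 1 in \<open>auto simp: cert_simps gauss_poly_def\<close>)
    moreover have "peval (cos_below 0 1 cos6) y \<le> cos (1 * y)"
      by (rule cos_ge_below(1)) auto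
    ultimately show ?thesis unfolding peval_padd peval_psmult by linarith
  next
    case 2
    have "peval (padd gauss_poly (psmult (- 297 / 1000) (cos_below 0 1 cos6))) y \<le> two_point y"
      by (rule two_point_ge_outer[where a = "1" and b = "5 / 4" and r = "1" and s = "2 / 5"])
        (use assms 2 in \<open>auto simp: cert_simps gauss_poly_def\<close>)
    moreover have "peval (cos_below 0 1 cos6) y \<le> cos (1 * y)"
      by (rule cos_ge_below(1)) auto
    ultimately show ?thesis unfolding peval_padd peval_psmult by linarith
  next
    case 3
    have "peval (padd gauss_poly (psmult (- 297 / 1000) (cos_below 1 1 cos8))) y \<le> two_point y"
      by (rule two_point_ge_outer[where a = "5 / 4" and b = "7 / 2" and r = "5 / 4" and s = "7 / 8"])
        (use assms 3 in \<open>auto simp: cert_simps gauss_poly_def\<close>)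
    moreover have "peval (cos_below 1 1 cos8) y \<le> cos (1 * y)"
      by (rule cos_ge_below(2)) auto
    ultimately show ?thesis unfolding peval_padd peval_psmult by linarith
  next
    case 4
    have "peval (padd gauss_poly (psmult (- 297 / 1000) (cos_below 2 1 cos10))) y \<le> two_point y"
      by (rule two_point_ge_outer[where a = "7 / 2" and b = "59 / 8" and r = "3 / 2" and s = "4 / 3"])
        (use assms 4 in \<open>auto simp: cert_simps gauss_poly_def\<close>)
    moreover have "peval (cos_below 2 1 cos10) y \<le> cos (1 * y)"
      by (rule cos_ge_below(1)) auto
    ultimately show ?thesis unfolding peval_padd peval_psmult by linarith
  next
    case 5
    have "peval (padd gauss_poly (psmult (- 297 / 1000) (cos_below 3 1 cos8))) y \<le> two_point y"
      by (rule two_point_ge_outer[where a = "59 / 8" and b = "91 / 8" and r = "5 / 3" and s = "3 / 2"])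
        (use assms 5 in \<open>auto simp: cert_simps gauss_poly_def\<close>)
    moreover have "peval (cos_below 3 1 cos8) y \<le> cos (1 * y)"
      by (rule cos_ge_below(2)) auto
    ultimately show ?thesis unfolding peval_padd peval_psmult by linarith
  next
    case 6
    have "peval (padd gauss_poly (psmult (- 297 / 1000) [- 1])) y \<le> two_point y"
      by (rule two_point_ge_tail[where a = "91 / 8" and r = "2" and s = "2"])
        (use assms 6 in \<open>auto simp: cert_simps gauss_poly_def\<close>)
    moreover have "peval [- 1] y \<le> cos (1 * y)"
      by simp
    ultimately show ?thesis unfolding peval_padd peval_psmult by linarith
  qed
qed

text \<open>A minorant of $|x|^{4/3}$ for Rademacher sums of variance $4$ without dominating coefficients.\<close>
definition "spread_poly = [29 / 50, 0, 201 / 500, 0, - 81 / 25000 :: real]"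

lemma powr_ge_spread_poly:
  fixes x :: real
  assumes "0 \<le> x"
  shows "peval spread_poly x - 117 / 250 * cos (5 / 4 * x) - 113 / 1000 * cos (5 / 2 * x)
    \<le> \<bar>x\<bar> powr (4 / 3)"
proof -
  \<comment> \<open>$p$ is a lower bound of the power, $u$ and $v$ are lower bounds of the two cosines\<close>
  have combine: "peval spread_poly x - 117 / 250 * cos (5 / 4 * x) - 113 / 1000 * cos (5 / 2 * x)
      \<le> \<bar>x\<bar> powr (4 / 3)"
    if "0 \<le> peval (padd p (psmult (- 1) (padd spread_poly
          (padd (psmult (- 117 / 250) u) (psmult (- 113 / 1000) v))))) x"
      and "peval p x \<le> \<bar>0 + 1 * x\<bar> powr (4 / 3)"
      and "peval u x \<le> cos (5 / 4 * x)" and "peval v x \<le> cos (5 / 2 * x)" for p u v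
    using that by simp
  note simps = cert_simps spread_poly_def
  consider "x \<le> 1 / 2" | "1 / 2 \<le> x" "x \<le> 2" | "2 \<le> x" "x \<le> 4" | "4 \<le> x" "x \<le> 13 / 2"
    | "13 / 2 \<le> x" "x \<le> 19 / 2" | "19 / 2 \<le> x"
    by linarith
  then show ?thesis
  proof cases
    case 1
    have "nonneg_on 0 (1 / 2) (padd (power_square (4 / 5) 0 1) (psmult (- 1) (padd spread_poly
        (padd (psmult (- 117 / 250) (cos_below 0 (5 / 4) cos2)) (psmult (- 113 / 1000) (cos_below 0 (5 / 2) cos2))))))"
      by (simp add: simps)
    from nonneg_onD[OF this assms 1] show ?thesis
    proof (rule combine)
      show "peval (power_square (4 / 5) 0 1) x \<le> \<bar>0 + 1 * x\<bar> powr (4 / 3)"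
        by (rule power_square_le) (use assms 1 in \<open>simp_all add: power3_eq_cube\<close>)
      show "peval (cos_below 0 (5 / 4) cos2) x \<le> cos (5 / 4 * x)"
        by (rule cos_ge_below(1)) simp_all
      show "peval (cos_below 0 (5 / 2) cos2) x \<le> cos (5 / 2 * x)"
        by (rule cos_ge_below(1)) simp_all
    qed
  next
    case 2
    have "nonneg_on (1 / 2) 2 (padd (taylor_cubic 1 0 1) (psmult (- 1) (padd spread_poly
        (padd (psmult (- 117 / 250) (cos_below 0 (5 / 4) cos10)) (psmult (- 113 / 1000) (cos_below 1 (5 / 2) cos4))))))"
      by (simp add: simps)
    from nonneg_onD[OF this 2] show ?thesis
    proof (rule combine)
      show "peval (taylor_cubic 1 0 1) x \<le> \<bar>0 + 1 * x\<bar> powr (4 / 3)"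
        by (rule taylor_cubic_le) (use 2 in \<open>simp_all\<close>)
      show "peval (cos_below 0 (5 / 4) cos10) x \<le> cos (5 / 4 * x)"
        by (rule cos_ge_below(1)) simp_all
      show "peval (cos_below 1 (5 / 2) cos4) x \<le> cos (5 / 2 * x)"
        by (rule cos_ge_below(2)) simp_all
    qed
  next
    case 3
    have "nonneg_on 2 4 (padd (taylor_cubic (3 / 2) 0 1) (psmult (- 1) (padd spread_poly
        (padd (psmult (- 117 / 250) (cos_below 1 (5 / 4) cos4)) (psmult (- 113 / 1000) (cos_below 2 (5 / 2) cos10))))))"
      by (simp add: simps)
    from nonneg_onD[OF this 3] show ?thesis
    proof (rule combine)
      show "peval (taylor_cubic (3 / 2) 0 1) x \<le> \<bar>0 + 1 * x\<bar> powr (4 / 3)"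
        by (rule taylor_cubic_le) (use 3 in \<open>simp_all\<close>)
      show "peval (cos_below 1 (5 / 4) cos4) x \<le> cos (5 / 4 * x)"
        by (rule cos_ge_below(2)) simp_all
      show "peval (cos_below 2 (5 / 2) cos10) x \<le> cos (5 / 2 * x)"
        by (rule cos_ge_below(1)) simp_all
    qed
  next
    case 4
    have "nonneg_on 4 (13 / 2) (padd (taylor_cubic (5 / 3) 0 1) (psmult (- 1) (padd spread_poly
        (padd (psmult (- 117 / 250) (cos_below 2 (5 / 4) cos6)) (psmult (- 113 / 1000) [- 1])))))"
      by (simp add: simps)
    from nonneg_onD[OF this 4] show ?thesis
    proof (rule combine)
      show "peval (taylor_cubic (5 / 3) 0 1) x \<le> \<bar>0 + 1 * x\<bar> powr (4 / 3)"
        by (rule taylor_cubic_le) (use 4 in \<open>simp_all\<close>)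
      show "peval (cos_below 2 (5 / 4) cos6) x \<le> cos (5 / 4 * x)"
        by (rule cos_ge_below(1)) simp_all
      show "peval [- 1] x \<le> cos (5 / 2 * x)"
        by simp
    qed
  next
    case 5
    have "nonneg_on (13 / 2) (19 / 2) (padd (taylor_cubic 2 0 1) (psmult (- 1) (padd spread_poly
        (padd (psmult (- 117 / 250) (cos_below 3 (5 / 4) cos4)) (psmult (- 113 / 1000) [- 1])))))"
      by (simp add: simps)
    from nonneg_onD[OF this 5] show ?thesis
    proof (rule combine)
      show "peval (taylor_cubic 2 0 1) x \<le> \<bar>0 + 1 * x\<bar> powr (4 / 3)"
        by (rule taylor_cubic_le) (use 5 in \<open>simp_all\<close>)
      show "peval (cos_below 3 (5 / 4) cos4) x \<le> cos (5 / 4 * x)"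
        by (rule cos_ge_below(2)) simp_all
      show "peval [- 1] x \<le> cos (5 / 2 * x)"
        by simp
    qed
  next
    case 6
    have "nonneg_from (19 / 2) (padd (taylor_cubic (7 / 3) 0 1) (psmult (- 1) (padd spread_poly
        (padd (psmult (- 117 / 250) [- 1]) (psmult (- 113 / 1000) [- 1])))))"
      by (simp add: simps)
    from nonneg_fromD[OF this 6] show ?thesis
    proof (rule combine)
      show "peval (taylor_cubic (7 / 3) 0 1) x \<le> \<bar>0 + 1 * x\<bar> powr (4 / 3)"
        by (rule taylor_cubic_le) (use 6 in \<open>simp_all\<close>)
      show "peval [- 1] x \<le> cos (5 / 4 * x)"
        by simp
      show "peval [- 1] x \<le> cos (5 / 2 * x)"
        by simp
    qed
  qed
qed

section \<open>Rademacher averages\<close>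

text \<open>A set $B$ stands for the choice of signs that is $+1$ on $B$ and $-1$ off $B$, so the power set of
$A$ enumerates all choices of signs on $A$.\<close>
definition sign_avg :: "'a set \<Rightarrow> ('a set \<Rightarrow> real) \<Rightarrow> real" where
  "sign_avg A F = (\<Sum>B\<in>Pow A. F B) / 2 ^ card A"

definition signed_sum :: "('a \<Rightarrow> real) \<Rightarrow> 'a set \<Rightarrow> 'a set \<Rightarrow> real" where
  "signed_sum c A B = (\<Sum>i\<in>A. if i \<in> B then c i else - c i)"

lemma sign_avg_empty [simp]: "sign_avg {} F = F {}"
  by (simp add: sign_avg_def)

lemma sign_avg_insert:
  assumes "finite A" and "x \<notin> A"
  shows "sign_avg (insert x A) F = sign_avg A (\<lambda>B. (F B + F (insert x B)) / 2)"
proof -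
  have "inj_on (insert x) (Pow A)"
    using assms(2) by (auto simp: inj_on_def)
  moreover have "Pow A \<inter> insert x ` Pow A = {}"
    using assms(2) by auto
  ultimately have "(\<Sum>B\<in>Pow (insert x A). F B) = (\<Sum>B\<in>Pow A. F B) + (\<Sum>B\<in>Pow A. F (insert x B))"
    unfolding Pow_insert using assms(1) by (simp add: sum.union_disjoint sum.reindex)
  then show ?thesis
    using assms by (simp add: sign_avg_def sum.distrib sum_divide_distrib[symmetric] field_simps)
qed

lemma sign_avg_cong: "(\<And>B. B \<subseteq> A \<Longrightarrow> F B = G B) \<Longrightarrow> sign_avg A F = sign_avg A G"
  by (simp add: sign_avg_def)

lemma sign_avg_mono: "(\<And>B. B \<subseteq> A \<Longrightarrow> F B \<le> G B) \<Longrightarrow> sign_avg A F \<le> sign_avg A G"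
  unfolding sign_avg_def by (intro divide_right_mono sum_mono) auto

lemma sign_avg_add: "sign_avg A (\<lambda>B. F B + G B) = sign_avg A F + sign_avg A G"
  by (simp add: sign_avg_def sum.distrib add_divide_distrib)

lemma sign_avg_mult: "sign_avg A (\<lambda>B. a * F B) = a * sign_avg A F"
  by (simp add: sign_avg_def sum_distrib_left)

lemma sign_avg_const [simp]: "finite A \<Longrightarrow> sign_avg A (\<lambda>B. a) = a"
  by (simp add: sign_avg_def card_Pow)

lemma sign_avg_sum: "finite I \<Longrightarrow> sign_avg A (\<lambda>B. \<Sum>i\<in>I. F i B) = (\<Sum>i\<in>I. sign_avg A (F i))"
proof (induction I rule: finite_induct)
  case empty
  show ?case by (simp add: sign_avg_def)
qed (simp add: sign_avg_add)

lemma sign_avg_le: "finite A \<Longrightarrow> (\<And>B. B \<subseteq> A \<Longrightarrow> F B \<le> a) \<Longrightarrow> sign_avg A F \<le> a"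
  using sign_avg_mono[of A F "\<lambda>_. a"] by simp

lemma sign_avg_nonneg: "(\<And>B. B \<subseteq> A \<Longrightarrow> 0 \<le> F B) \<Longrightarrow> 0 \<le> sign_avg A F"
  unfolding sign_avg_def by (intro divide_nonneg_pos sum_nonneg) auto

text \<open>The expectation of $f(\sum_{i \in A} \varepsilon_i c_i)$ for independent random signs.\<close>
definition rademacher :: "('a \<Rightarrow> real) \<Rightarrow> 'a set \<Rightarrow> (real \<Rightarrow> real) \<Rightarrow> real" where
  "rademacher c A f = sign_avg A (\<lambda>B. f (signed_sum c A B))"

lemma rademacher_empty [simp]: "rademacher c {} f = f 0"
  by (simp add: rademacher_def signed_sum_def)

lemma rademacher_insert:
  assumes "finite A" and "x \<notin> A"
  shows "rademacher c (insert x A) f = rademacher c A (\<lambda>s. (f (s - c x) + f (s + c x)) / 2)"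
proof -
  have "signed_sum c (insert x A) B = signed_sum c A B - c x"
    and "signed_sum c (insert x A) (insert x B) = signed_sum c A B + c x" if "B \<subseteq> A" for B
  proof -
    show "signed_sum c (insert x A) B = signed_sum c A B - c x"
      using assms that unfolding signed_sum_def by (auto simp: sum.insert)
    have "(\<Sum>i\<in>A. if i \<in> insert x B then c i else - c i) = (\<Sum>i\<in>A. if i \<in> B then c i else - c i)"
      using assms by (intro sum.cong) auto
    then show "signed_sum c (insert x A) (insert x B) = signed_sum c A B + c x"
      using assms unfolding signed_sum_def by (subst sum.insert) auto
  qed
  then show ?thesis
    unfolding rademacher_def sign_avg_insert[OF assms] by (intro sign_avg_cong) simp
qed

lemma rademacher_mono: "(\<And>s. f s \<le> g s) \<Longrightarrow> rademacher c A f \<le> rademacher c A g"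
  unfolding rademacher_def by (intro sign_avg_mono) auto

lemma rademacher_add: "rademacher c A (\<lambda>s. f s + g s) = rademacher c A f + rademacher c A g"
  by (simp add: rademacher_def sign_avg_add)

lemma rademacher_mult: "rademacher c A (\<lambda>s. a * f s) = a * rademacher c A f"
  by (simp add: rademacher_def sign_avg_mult)

lemma rademacher_diff: "rademacher c A (\<lambda>s. f s - g s) = rademacher c A f - rademacher c A g"
  using rademacher_add[of c A f "\<lambda>s. - 1 * g s"] rademacher_mult[of c A "- 1" g] by simp

lemma rademacher_const [simp]: "finite A \<Longrightarrow> rademacher c A (\<lambda>s. a) = a"
  by (simp add: rademacher_def)

lemma rademacher_scale: "rademacher (\<lambda>i. r * c i) A f = rademacher c A (\<lambda>s. f (r * s))"
proof -
  have "signed_sum (\<lambda>i. r * c i) A B = r * signed_sum c A B" for B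
    unfolding signed_sum_def sum_distrib_left by (intro sum.cong) auto
  then show ?thesis by (simp add: rademacher_def)
qed

text \<open>All moments follow by adding one summand at a time: averaging over its sign removes the odd powers
of the new coefficient.\<close>
lemma rademacher_moment2: "finite A \<Longrightarrow> rademacher c A (\<lambda>s. s ^ 2) = (\<Sum>i\<in>A. c i ^ 2)"
proof (induction A rule: finite_induct)
  case (insert x A)
  have "rademacher c (insert x A) (\<lambda>s. s ^ 2) = rademacher c A (\<lambda>s. s ^ 2 + c x ^ 2)"
    unfolding rademacher_insert[OF insert(1,2)]
    by (rule arg_cong[where f = "rademacher c A"]) (simp add: fun_eq_iff power2_eq_square field_simps)
  also have "\<dots> = (\<Sum>i\<in>insert x A. c i ^ 2)"
    using insert by (simp add: rademacher_add)
  finally show ?case .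
qed simp

lemma rademacher_moment4:
  "finite A \<Longrightarrow> rademacher c A (\<lambda>s. s ^ 4) = 3 * (\<Sum>i\<in>A. c i ^ 2) ^ 2 - 2 * (\<Sum>i\<in>A. c i ^ 4)"
proof (induction A rule: finite_induct)
  case (insert x A)
  have "rademacher c (insert x A) (\<lambda>s. s ^ 4) = rademacher c A (\<lambda>s. s ^ 4 + 6 * c x ^ 2 * s ^ 2 + c x ^ 4)"
    unfolding rademacher_insert[OF insert(1,2)]
    by (rule arg_cong[where f = "rademacher c A"]) (simp add: fun_eq_iff eval_nat_numeral field_simps)
  also have "\<dots> = 3 * (\<Sum>i\<in>insert x A. c i ^ 2) ^ 2 - 2 * (\<Sum>i\<in>insert x A. c i ^ 4)"
    using insert by (simp add: rademacher_add rademacher_mult rademacher_moment2) (simp add: eval_nat_numeral field_simps)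
  finally show ?case .
qed simp

lemma rademacher_moment6:
  "finite A \<Longrightarrow> rademacher c A (\<lambda>s. s ^ 6) = 15 * (\<Sum>i\<in>A. c i ^ 2) ^ 3
     - 30 * (\<Sum>i\<in>A. c i ^ 2) * (\<Sum>i\<in>A. c i ^ 4) + 16 * (\<Sum>i\<in>A. c i ^ 6)"
proof (induction A rule: finite_induct)
  case (insert x A)
  have "rademacher c (insert x A) (\<lambda>s. s ^ 6)
      = rademacher c A (\<lambda>s. s ^ 6 + 15 * c x ^ 2 * s ^ 4 + 15 * c x ^ 4 * s ^ 2 + c x ^ 6)"
    unfolding rademacher_insert[OF insert(1,2)]
    by (rule arg_cong[where f = "rademacher c A"]) (simp add: fun_eq_iff eval_nat_numeral field_simps)
  also have "\<dots> = 15 * (\<Sum>i\<in>insert x A. c i ^ 2) ^ 3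
     - 30 * (\<Sum>i\<in>insert x A. c i ^ 2) * (\<Sum>i\<in>insert x A. c i ^ 4) + 16 * (\<Sum>i\<in>insert x A. c i ^ 6)"
    using insert by (simp add: rademacher_add rademacher_mult rademacher_moment2 rademacher_moment4)
      (simp add: eval_nat_numeral field_simps)
  finally show ?case .
qed simp

text \<open>The addition theorem for $\cos(ts \pm tc)$: the sines cancel, so the average is a product.\<close>
lemma rademacher_cos: "finite A \<Longrightarrow> rademacher c A (\<lambda>s. cos (t * s)) = (\<Prod>i\<in>A. cos (t * c i))"
proof (induction A rule: finite_induct)
  case (insert x A)
  have "rademacher c (insert x A) (\<lambda>s. cos (t * s)) = rademacher c A (\<lambda>s. cos (t * c x) * cos (t * s))"
    unfolding rademacher_insert[OF insert(1,2)]
    by (rule arg_cong[where f = "rademacher c A"])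
      (simp add: fun_eq_iff right_diff_distrib distrib_left cos_add cos_diff)
  also have "\<dots> = (\<Prod>i\<in>insert x A. cos (t * c i))"
    using insert by (simp add: rademacher_mult)
  finally show ?case .
qed simp

text \<open>For $u = z^2/2 \le 2$ one has $\cos z \le 1 - u + u^2/6 \le 1 - u + u^2/2 - u^3/6 \le e^{-u}$.\<close>
lemma cos_le_exp:
  fixes z :: real
  assumes "\<bar>z\<bar> \<le> 2"
  shows "cos z \<le> exp (- z\<^sup>2 / 2)"
proof -
  define u where "u = z\<^sup>2 / 2"
  have u: "0 \<le> u" "u \<le> 2"
    using assms power_mono[of "\<bar>z\<bar>" 2 2] by (simp_all add: u_def)
  obtain t where t: "exp (- u) = (\<Sum>m<4. (- u) ^ m / fact m) + exp t / fact 4 * (- u) ^ 4"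
    using Maclaurin_exp_le[of "- u" 4] by blast
  have "cos z \<le> 1 - u + u\<^sup>2 / 6"
    using cos_taylor(2)[of z] by (simp add: cos4_def u_def eval_nat_numeral field_simps)
  also have "\<dots> \<le> 1 - u + u\<^sup>2 / 2 - u ^ 3 / 6"
    using mult_right_mono[OF u(2), of "u\<^sup>2"] by (simp add: eval_nat_numeral field_simps)
  also have "\<dots> = (\<Sum>m<4. (- u) ^ m / fact m)"
    by (simp add: eval_nat_numeral field_simps)
  also have "\<dots> \<le> exp (- u)"
    unfolding t by simp
  finally show ?thesis by (simp add: u_def)
qed

text \<open>The bound $157/100 < \pi/2$ keeps all factors of the product nonnegative, so that they may be
estimated one by one.\<close>
lemma rademacher_cos_bounds:
  assumes "finite A" and "\<And>i. i \<in> A \<Longrightarrow> \<bar>t * c i\<bar> \<le> 157 / 100"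
  shows "0 \<le> rademacher c A (\<lambda>s. cos (t * s))"
    and "rademacher c A (\<lambda>s. cos (t * s)) \<le> exp (- t\<^sup>2 * (\<Sum>i\<in>A. c i ^ 2) / 2)"
proof -
  have "157 / 100 \<le> pi / 2" using pi_near unfolding abs_le_iff by linarith
  then have pos: "0 \<le> cos (t * c i)" if "i \<in> A" for i
    using assms(2)[OF that] by (intro cos_ge_zero) auto
  show "0 \<le> rademacher c A (\<lambda>s. cos (t * s))"
    unfolding rademacher_cos[OF assms(1)] using pos by (intro prod_nonneg) auto
  have "rademacher c A (\<lambda>s. cos (t * s)) \<le> (\<Prod>i\<in>A. exp (- (t * c i)\<^sup>2 / 2))"
    unfolding rademacher_cos[OF assms(1)] using pos assms(2)
    by (intro prod_mono conjI cos_le_exp) fastforce+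
  also have "\<dots> = exp (- t\<^sup>2 * (\<Sum>i\<in>A. c i ^ 2) / 2)"
    unfolding exp_sum[OF assms(1), symmetric]
    by (simp add: sum_negf sum_divide_distrib sum_distrib_left power_mult_distrib)
  finally show "rademacher c A (\<lambda>s. cos (t * s)) \<le> exp (- t\<^sup>2 * (\<Sum>i\<in>A. c i ^ 2) / 2)" .
qed

section \<open>The sharp Khinchine inequality with exponent 4/3\<close>

text \<open>The tangent of the concave function $s^{2/3}$ at $s = r^3$; with rational $r$ it turns the irrational
bound to be proved into an affine one.\<close>
lemma powr_two_thirds_tangent:
  fixes r s :: real
  assumes "0 < r" and "0 \<le> s"
  shows "s powr (2 / 3) \<le> r\<^sup>2 / 3 + 2 * s / (3 * r)"
proof -
  define q where "q = s powr (1 / 3)"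
  have q: "0 \<le> q" by (simp add: q_def)
  have s: "s = q ^ 3" and e: "s powr (2 / 3) = q\<^sup>2"
    using assms by (cases "s = 0"; simp add: q_def powr_powr flip: powr_numeral)+
  have "0 \<le> (q - r)\<^sup>2 * (2 * q + r)" using assms q by simp
  also have "\<dots> = r ^ 3 + 2 * q ^ 3 - 3 * r * q\<^sup>2" by (simp add: eval_nat_numeral algebra_simps)
  finally have "3 * r * q\<^sup>2 \<le> r ^ 3 + 2 * q ^ 3" by simp
  then have "q\<^sup>2 \<le> r\<^sup>2 / 3 + 2 * q ^ 3 / (3 * r)"
    using assms by (simp add: field_simps eval_nat_numeral)
  then show ?thesis unfolding e s[symmetric] .
qed

lemma two_point_minus [simp]: "two_point (- y) = two_point y"
  by (simp add: two_point_def add.commute)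

lemma two_point_abs: "two_point \<bar>y\<bar> = two_point y"
  by (cases "0 \<le> y") auto

lemma abs_mult_abs_left: "\<bar>s\<bar> * (\<bar>s\<bar> * x) = s * (s * x)" for s x :: real
  by (simp flip: mult.assoc)

lemma two_point_ge_low:
  "509 / 750 + 46139 / 150000 * s\<^sup>2 + 387 / 25000 * s ^ 4 - 87 / 50000 * s ^ 6 \<le> two_point s"
  using two_point_ge_low_poly[of "\<bar>s\<bar>"]
  by (simp add: two_point_abs low_poly_def abs_mult_abs_left eval_nat_numeral algebra_simps)

lemma two_point_ge_mid:
  "1901 / 2500 + 2071 / 10000 * s\<^sup>2 + 1637 / 50000 * s ^ 4 - 2449 / 1000000 * s ^ 6 \<le> two_point s"
  using two_point_ge_mid_poly[of "\<bar>s\<bar>"]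
  by (simp add: two_point_abs mid_poly_def abs_mult_abs_left eval_nat_numeral algebra_simps)

lemma two_point_ge_spiked: "607 / 1000 + 801 / 2000 * s\<^sup>2 - 43 / 5000 * s ^ 4 \<le> two_point s"
  using two_point_ge_spiked_poly[of "\<bar>s\<bar>"]
  by (simp add: two_point_abs spiked_poly_def abs_mult_abs_left eval_nat_numeral algebra_simps)

lemma cos_abs_mult: "cos (a * \<bar>s\<bar>) = cos (a * s)" for a s :: real
  by (cases "0 \<le> s") auto

lemma two_point_ge_flat:
  "653 / 1000 + 751 / 2000 * s\<^sup>2 - 37 / 5000 * s ^ 4 + 57 / 500 * cos (16 / 9 * s) \<le> two_point s"
  using two_point_ge_flat_poly[of "\<bar>s\<bar>"] unfolding cos_abs_mult two_point_abs
  by (simp add: flat_poly_def abs_mult_abs_left eval_nat_numeral algebra_simps)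

lemma two_point_ge_gauss:
  "111 / 125 + 2713 / 10000 * s\<^sup>2 - 69 / 50000 * s ^ 4 - 297 / 1000 * cos (1 * s) \<le> two_point s"
  using two_point_ge_gauss_poly[of "\<bar>s\<bar>"] unfolding cos_abs_mult two_point_abs
  by (simp add: gauss_poly_def abs_mult_abs_left eval_nat_numeral algebra_simps)

lemma powr_ge_spread:
  fixes s :: real
  shows "29 / 50 + 201 / 500 * s\<^sup>2 - 81 / 25000 * s ^ 4 - 117 / 250 * cos (5 / 4 * s) - 113 / 1000 * cos (5 / 2 * s)
    \<le> \<bar>s\<bar> powr (4 / 3)"
  using powr_ge_spread_poly[of "\<bar>s\<bar>"] unfolding cos_abs_mult
  by (simp add: spread_poly_def abs_mult_abs_left eval_nat_numeral algebra_simps)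

lemma affine_nonneg_between:
  fixes a k p P :: real
  assumes "0 \<le> a" and "0 \<le> a + k * P" and "0 \<le> p" and "p \<le> P"
  shows "0 \<le> a + k * p"
proof (cases "0 \<le> k")
  case False
  then have "k * P \<le> k * p" using assms(4) by (simp add: mult_left_mono_neg)
  then show ?thesis using assms(2) by simp
qed (use assms in simp)

text \<open>Convexity: below its secant the exponential is replaced by a function that is affine in $w$.\<close>
lemma exp_secant:
  fixes a b w :: real
  assumes "a \<le> w" and "w \<le> b" and "a < b"
    and "exp (- a / 2) \<le> ea" and "exp (- b / 2) \<le> eb"
  shows "exp (- w / 2) \<le> ((b - w) * ea + (w - a) * eb) / (b - a)"
proof -
  define t where "t = (w - a) / (b - a)"
  have t: "0 \<le> t" "t \<le> 1" "1 - t = (b - w) / (b - a)" using assms by (auto simp: t_def field_simps)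
  have "w = a + t * (b - a)" using assms by (simp add: t_def)
  then have w: "- w / 2 = (1 - t) * (- a / 2) + t * (- b / 2)" by (simp add: field_simps)
  have "exp (- w / 2) \<le> (1 - t) * exp (- a / 2) + t * exp (- b / 2)"
    unfolding w using convex_onD[OF exp_convex, of t "- a / 2" "- b / 2"] t by simp
  also have "\<dots> \<le> (1 - t) * ea + t * eb"
    using assms t by (intro add_mono mult_left_mono) auto
  also have "\<dots> = ((b - w) * ea + (w - a) * eb) / (b - a)"
    unfolding t(3) by (simp add: t_def add_divide_distrib)
  finally show ?thesis .
qed

lemma exp_bounds:
  "exp (- (12 / 5) / 2) \<le> (189 / 625 :: real)" "exp (- (21 / 5) / 2) \<le> (123 / 1000 :: real)"
  "exp (- 10 / 2) \<le> (17 / 2500 :: real)" "exp (- (5 / 4)\<^sup>2 * 4 / 2) \<le> (1 / 20 :: real)"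
  "exp (- (5 / 2)\<^sup>2 * 4 / 2) \<le> (1 / 1000 :: real)"
proof -
  have e: "exp (- (real n * x)) \<le> 1 / (1 + x + x\<^sup>2 / 2) ^ n" if "0 \<le> x" for n x
  proof -
    have "(1 + x + x\<^sup>2 / 2) ^ n \<le> exp x ^ n"
      using exp_lower_Taylor_quadratic[OF that] that by (intro power_mono) auto
    then have "1 / exp x ^ n \<le> 1 / (1 + x + x\<^sup>2 / 2) ^ n"
      using that by (intro divide_left_mono) (auto intro!: mult_pos_pos zero_less_power add_pos_nonneg)
    then show ?thesis
      by (simp add: exp_minus exp_of_nat_mult inverse_eq_divide)
  qed
  show "exp (- (12 / 5) / 2) \<le> (189 / 625 :: real)"
    using e[of "1 / 10" 12] by (simp add: power_divide power2_eq_square)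
  show "exp (- (21 / 5) / 2) \<le> (123 / 1000 :: real)"
    using e[of "1 / 10" 21] by (simp add: power_divide power2_eq_square)
  show "exp (- 10 / 2) \<le> (17 / 2500 :: real)"
    using e[of "1 / 10" 50] by (simp add: power_divide power2_eq_square)
  show "exp (- (5 / 4)\<^sup>2 * 4 / 2) \<le> (1 / 20 :: real)"
    using e[of "25 / 64" 8] by (simp add: power_divide power2_eq_square)
  show "exp (- (5 / 2)\<^sup>2 * 4 / 2) \<le> (1 / 1000 :: real)"
    using e[of "1 / 2" 25] by (simp add: power_divide power2_eq_square)
qed

text \<open>The coefficients of $Y$, that is, those besides the largest one, which is normalized to $1$.  The
moments up to the sixth depend on them only through the power sums $w$, $p_2$ and $p_3$ of their
squares.\<close>
locale small_coefficients =
  fixes c :: "'a \<Rightarrow> real" and A :: "'a set" and w p2 p3 :: real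
  assumes finite: "finite A" and le_1: "\<And>i. i \<in> A \<Longrightarrow> \<bar>c i\<bar> \<le> 1"
    and w_eq: "w = (\<Sum>i\<in>A. c i ^ 2)" and p2_eq: "p2 = (\<Sum>i\<in>A. c i ^ 4)"
    and p3_eq: "p3 = (\<Sum>i\<in>A. c i ^ 6)"
begin

lemma moments:
  shows "rademacher c A (\<lambda>s. s ^ 2) = w" and "rademacher c A (\<lambda>s. s ^ 4) = 3 * w\<^sup>2 - 2 * p2"
    and "rademacher c A (\<lambda>s. s ^ 6) = 15 * w ^ 3 - 30 * w * p2 + 16 * p3"
  using finite by (simp_all add: rademacher_moment2 rademacher_moment4 rademacher_moment6 w_eq p2_eq p3_eq)

lemma c_sq: "i \<in> A \<Longrightarrow> c i ^ 2 \<le> 1"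
  using le_1[of i] by (simp add: abs_square_le_1)

lemma w_nonneg: "0 \<le> w" by (simp add: w_eq sum_nonneg)
lemma p2_nonneg: "0 \<le> p2" by (simp add: p2_eq sum_nonneg)

lemma c_sq_le_w: "i \<in> A \<Longrightarrow> c i ^ 2 \<le> w"
  unfolding w_eq using finite by (intro member_le_sum) auto

lemma p2_le: "p2 \<le> w" "p2 \<le> w\<^sup>2"
proof -
  have "c i ^ 4 = c i ^ 2 * c i ^ 2" for i
    by (simp flip: power_add)
  then have "c i ^ 4 \<le> 1 * c i ^ 2" "c i ^ 4 \<le> w * c i ^ 2" if "i \<in> A" for i
    using c_sq[OF that] c_sq_le_w[OF that] by (simp_all only: mult_right_mono zero_le_power2)
  then have "p2 \<le> (\<Sum>i\<in>A. 1 * c i ^ 2)" and "p2 \<le> (\<Sum>i\<in>A. w * c i ^ 2)"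
    unfolding p2_eq by (intro sum_mono; blast)+
  then show "p2 \<le> w" and "p2 \<le> w\<^sup>2"
    unfolding sum_distrib_left[symmetric] w_eq[symmetric] by (simp_all add: power2_eq_square)
qed

lemma p3_le: "p3 \<le> p2" "p3 \<le> w * p2"
proof -
  have "c i ^ 6 = c i ^ 2 * c i ^ 4" for i
    by (simp flip: power_add)
  then have "c i ^ 6 \<le> 1 * c i ^ 4" "c i ^ 6 \<le> w * c i ^ 4" if "i \<in> A" for i
    using c_sq[OF that] c_sq_le_w[OF that] by (simp_all only: mult_right_mono zero_le_even_power even_numeral)
  then have "p3 \<le> (\<Sum>i\<in>A. 1 * c i ^ 4)" and "p3 \<le> (\<Sum>i\<in>A. w * c i ^ 4)"
    unfolding p3_eq by (intro sum_mono; blast)+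
  then show "p3 \<le> p2" and "p3 \<le> w * p2"
    by (simp_all only: p2_eq[symmetric] sum_distrib_left[symmetric] mult_1)
qed

lemma target_le_tangent: "0 < r \<Longrightarrow> ((1 + w) / 2) powr (2 / 3) \<le> r\<^sup>2 / 3 + (1 + w) / (3 * r)"
  using powr_two_thirds_tangent[of r "(1 + w) / 2"] w_nonneg by (simp add: field_simps)

text \<open>Compared with the tangent $(2+w)/3$ of $((1+w)/2)^{2/3}$ at $w = 1$, the surplus $D$ of the minorant
is the average of $(Y^2-1)^2(k_0-k_1Y^2)$, which is affine in $p_2$ and $p_3$.  For $w \le 1$ it is
smallest at $p_2 = w^2$, $p_3 = w^3$, where there is a single coefficient and the average is
$(1-w)^2(k_0-k_1w)$.  For $w \ge 1$ both extreme values $0$ and $w$ of $p_2$ are checked.\<close>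
lemma two_point_bound_low:
  assumes "w \<le> 6 / 5"
  shows "((1 + w) / 2) powr (2 / 3) \<le> rademacher c A two_point"
proof -
  let ?k0 = "3 / 250 :: real" and ?k1 = "87 / 50000 :: real"
  define g where "g = ?k0 - (2 * ?k0 + ?k1) * w + 3 * (?k0 + 2 * ?k1) * w\<^sup>2 - 15 * ?k1 * w ^ 3"
  define D where "D = g + (30 * ?k1 * w - 2 * (?k0 + 2 * ?k1)) * p2 - 16 * ?k1 * p3"
  have "0 \<le> D"
  proof (cases "w \<le> 1")
    case True
    have "0 \<le> (1 - w)\<^sup>2 * (?k0 - ?k1 * w)" using True w_nonneg by simp
    also have "\<dots> = g + (14 * ?k1 * w - 2 * (?k0 + 2 * ?k1)) * w\<^sup>2"
      by (simp add: g_def eval_nat_numeral field_simps)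
    also have "\<dots> \<le> g + (14 * ?k1 * w - 2 * (?k0 + 2 * ?k1)) * p2"
      using True p2_le(2) by (intro add_left_mono mult_left_mono_neg) auto
    also have "\<dots> \<le> g + (30 * ?k1 * w - 2 * (?k0 + 2 * ?k1)) * p2 - 16 * ?k1 * p3"
      using p3_le(2) by (simp add: algebra_simps)
    finally show ?thesis unfolding D_def .
  next
    case False
    have "nonneg_on 1 (6 / 5) [?k0, - (2 * ?k0 + ?k1), 3 * (?k0 + 2 * ?k1), - 15 * ?k1]"
      by (simp add: cert_simps)
    from nonneg_onD[OF this, of w] have g: "0 \<le> g"
      using False assms by (simp add: g_def eval_nat_numeral field_simps)
    have "nonneg_on 1 (6 / 5) [?k0, - (4 * ?k0 + 21 * ?k1), 3 * (?k0 + 12 * ?k1), - 15 * ?k1]"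
      by (simp add: cert_simps)
    from nonneg_onD[OF this, of w] have "0 \<le> g + (30 * ?k1 * w - 2 * ?k0 - 20 * ?k1) * w"
      using False assms by (simp add: g_def eval_nat_numeral field_simps)
    with g have "0 \<le> g + (30 * ?k1 * w - 2 * ?k0 - 20 * ?k1) * p2"
      using p2_nonneg p2_le(1) by (rule affine_nonneg_between)
    also have "\<dots> \<le> g + (30 * ?k1 * w - 2 * (?k0 + 2 * ?k1)) * p2 - 16 * ?k1 * p3"
      using p3_le(1) by (simp add: algebra_simps)
    finally show ?thesis unfolding D_def .
  qed
  moreover have "rademacher c A (\<lambda>s. 509 / 750 + 46139 / 150000 * s\<^sup>2 + 387 / 25000 * s ^ 4 - 87 / 50000 * s ^ 6)
      = (1\<^sup>2 / 3 + (1 + w) / (3 * 1)) + D"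
    using finite unfolding rademacher_diff rademacher_add rademacher_mult moments by (simp add: D_def g_def field_simps)
  moreover have "rademacher c A (\<lambda>s. 509 / 750 + 46139 / 150000 * s\<^sup>2 + 387 / 25000 * s ^ 4 - 87 / 50000 * s ^ 6)
      \<le> rademacher c A two_point"
    using two_point_ge_low by (intro rademacher_mono)
  ultimately show ?thesis using target_le_tangent[of 1] by linarith
qed

text \<open>After estimating $p_3 \le p_2$ the average is affine in $p_2 \in [0,w]$, and at both ends it is a
cubic polynomial in $w$ above the tangent of the right-hand side at $r = 53/50$.\<close>
lemma two_point_bound_mid:
  assumes "6 / 5 \<le> w" "w \<le> 8 / 5"
  shows "((1 + w) / 2) powr (2 / 3) \<le> rademacher c A two_point"
proof -
  let ?b = "2071 / 10000 :: real" and ?c = "1637 / 50000 :: real" and ?d = "2449 / 1000000 :: real"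
  let ?r = "53 / 50 :: real"
  define g where "g = 1901 / 2500 + ?b * w + 3 * ?c * w\<^sup>2 - 15 * ?d * w ^ 3 - (?r\<^sup>2 / 3 + (1 + w) / (3 * ?r))"
  have "nonneg_on (6 / 5) (8 / 5) (padd [1901 / 2500, ?b, 3 * ?c, - 15 * ?d] [- (?r\<^sup>2 / 3 + 1 / (3 * ?r)), - (1 / (3 * ?r))])"
    by (simp add: cert_simps)
  from nonneg_onD[OF this, of w] have g: "0 \<le> g"
    using assms by (simp add: g_def eval_nat_numeral field_simps)
  have "nonneg_on (6 / 5) (8 / 5) (padd [1901 / 2500, ?b - 2 * ?c - 16 * ?d, 3 * ?c + 30 * ?d, - 15 * ?d] [- (?r\<^sup>2 / 3 + 1 / (3 * ?r)), - (1 / (3 * ?r))])"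
    by (simp add: cert_simps)
  from nonneg_onD[OF this, of w] have "0 \<le> g + (30 * ?d * w - 2 * ?c - 16 * ?d) * w"
    using assms by (simp add: g_def eval_nat_numeral field_simps)
  with g have "0 \<le> g + (30 * ?d * w - 2 * ?c - 16 * ?d) * p2"
    using p2_nonneg p2_le(1) by (rule affine_nonneg_between)
  also have "\<dots> \<le> g + (30 * ?d * w - 2 * ?c) * p2 - 16 * ?d * p3"
    using p3_le(1) by (simp add: algebra_simps)
  also have "\<dots> = rademacher c A (\<lambda>s. 1901 / 2500 + ?b * s ^ 2 + ?c * s ^ 4 - ?d * s ^ 6) - (?r\<^sup>2 / 3 + (1 + w) / (3 * ?r))"
    using finite unfolding rademacher_diff rademacher_add rademacher_mult moments by (simp add: g_def field_simps)
  also have "rademacher c A (\<lambda>s. 1901 / 2500 + ?b * s ^ 2 + ?c * s ^ 4 - ?d * s ^ 6) \<le> rademacher c A two_point"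
    using two_point_ge_mid by (intro rademacher_mono)
  finally show ?thesis using target_le_tangent[of ?r] by simp
qed

text \<open>The large coefficient contributes $(22/25)^4$ to $p_2$, which improves the fourth moment.\<close>
lemma two_point_bound_spiked:
  assumes "8 / 5 \<le> w" "w \<le> 12 / 5" and "j \<in> A" "22 / 25 \<le> \<bar>c j\<bar>"
  shows "((1 + w) / 2) powr (2 / 3) \<le> rademacher c A two_point"
proof -
  let ?p = "(22 / 25) ^ 4 :: real"
  have "?p \<le> \<bar>c j\<bar> ^ 4" using assms(4) by (intro power_mono) auto
  also have "\<dots> \<le> p2"
    unfolding p2_eq using finite assms(3) member_le_sum[of j A "\<lambda>i. c i ^ 4"] by simp
  finally have p: "?p \<le> p2" .
  have "607 / 1000 + 801 / 2000 * w - 43 / 5000 * (3 * w\<^sup>2 - 2 * p2)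
      = rademacher c A (\<lambda>s. 607 / 1000 + 801 / 2000 * s\<^sup>2 - 43 / 5000 * s ^ 4)"
    using finite unfolding rademacher_diff rademacher_add rademacher_mult moments by simp
  also have "\<dots> \<le> rademacher c A two_point"
    using two_point_ge_spiked by (intro rademacher_mono)
  finally have lower: "607 / 1000 + 43 / 2500 * ?p + 801 / 2000 * w - 129 / 5000 * w\<^sup>2 \<le> rademacher c A two_point"
    using p by (simp add: field_simps)
  show ?thesis
  proof (cases "w \<le> 2")
    case True
    have "nonneg_on (8 / 5) 2 (padd [607 / 1000 + 43 / 2500 * ?p, 801 / 2000, - 129 / 5000]
        [- ((27 / 25)\<^sup>2 / 3 + 1 / (3 * (27 / 25))), - (1 / (3 * (27 / 25)))])"
      by (simp add: cert_simps)
    from nonneg_onD[OF this, of w] show ?thesis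
      using True assms lower target_le_tangent[of "27 / 25"] by (simp add: eval_nat_numeral field_simps)
  next
    case False
    have "nonneg_on 2 (12 / 5) (padd [607 / 1000 + 43 / 2500 * ?p, 801 / 2000, - 129 / 5000]
        [- ((113 / 100)\<^sup>2 / 3 + 1 / (3 * (113 / 100))), - (1 / (3 * (113 / 100)))])"
      by (simp add: cert_simps)
    from nonneg_onD[OF this, of w] show ?thesis
      using False assms lower target_le_tangent[of "113 / 100"] by (simp add: eval_nat_numeral field_simps)
  qed
qed

lemma two_point_bound_flat:
  assumes "8 / 5 \<le> w" "w \<le> 12 / 5" and "\<And>i. i \<in> A \<Longrightarrow> \<bar>c i\<bar> \<le> 22 / 25"
  shows "((1 + w) / 2) powr (2 / 3) \<le> rademacher c A two_point"
proof -
  have "0 \<le> rademacher c A (\<lambda>s. cos (16 / 9 * s))"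
    using assms(3) finite by (intro rademacher_cos_bounds) (fastforce simp: abs_mult)+
  moreover have "653 / 1000 + 751 / 2000 * w - 37 / 5000 * (3 * w\<^sup>2 - 2 * p2) + 57 / 500 * rademacher c A (\<lambda>s. cos (16 / 9 * s))
      = rademacher c A (\<lambda>s. 653 / 1000 + 751 / 2000 * s\<^sup>2 - 37 / 5000 * s ^ 4 + 57 / 500 * cos (16 / 9 * s))"
    using finite unfolding rademacher_diff rademacher_add rademacher_mult moments by simp
  moreover have "\<dots> \<le> rademacher c A two_point"
    using two_point_ge_flat by (intro rademacher_mono)
  ultimately have lower: "653 / 1000 + 751 / 2000 * w - 111 / 5000 * w\<^sup>2 \<le> rademacher c A two_point"
    using p2_nonneg by (simp add: field_simps)
  have "nonneg_on (8 / 5) (12 / 5) (padd [653 / 1000, 751 / 2000, - 111 / 5000]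
      [- ((29 / 25)\<^sup>2 / 3 + 1 / (3 * (29 / 25))), - (1 / (3 * (29 / 25)))])"
    by (simp add: cert_simps)
  from nonneg_onD[OF this, of w] show ?thesis
    using assms lower target_le_tangent[of "29 / 25"] by (simp add: power2_eq_square field_simps)
qed

text \<open>On both halves of the range the exponential is replaced by its secant, and the resulting concave
quadratic in $w$ is compared with a tangent of the right-hand side.\<close>
lemma two_point_bound_gauss:
  assumes "12 / 5 \<le> w" "w \<le> 10"
  shows "((1 + w) / 2) powr (2 / 3) \<le> rademacher c A two_point"
proof -
  have "rademacher c A (\<lambda>s. cos (1 * s)) \<le> exp (- 1\<^sup>2 * (\<Sum>i\<in>A. c i ^ 2) / 2)"
    using le_1 finite by (intro rademacher_cos_bounds) fastforce+
  then have cos: "rademacher c A (\<lambda>s. cos (1 * s)) \<le> exp (- w / 2)" by (simp flip: w_eq)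
  have "111 / 125 + 2713 / 10000 * w - 69 / 50000 * (3 * w\<^sup>2 - 2 * p2) - 297 / 1000 * rademacher c A (\<lambda>s. cos (1 * s))
      = rademacher c A (\<lambda>s. 111 / 125 + 2713 / 10000 * s\<^sup>2 - 69 / 50000 * s ^ 4 - 297 / 1000 * cos (1 * s))"
    using finite unfolding rademacher_diff rademacher_add rademacher_mult moments by simp
  also have "\<dots> \<le> rademacher c A two_point"
    using two_point_ge_gauss by (intro rademacher_mono)
  finally have lower: "111 / 125 + 2713 / 10000 * w - 207 / 50000 * w\<^sup>2 - 297 / 1000 * exp (- w / 2) \<le> rademacher c A two_point"
    using p2_nonneg cos by (simp add: field_simps)
  show ?thesis
  proof (cases "w \<le> 21 / 5")
    case True
    have "exp (- w / 2) \<le> ((21 / 5 - w) * (189 / 625) + (w - 12 / 5) * (123 / 1000)) / (21 / 5 - 12 / 5)"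
      using exp_bounds True assms by (intro exp_secant) auto
    then have lower': "111 / 125 + 2713 / 10000 * w - 207 / 50000 * w\<^sup>2
        - 297 / 1000 * (((21 / 5 - w) * (189 / 625) + (w - 12 / 5) * (123 / 1000)) / (9 / 5)) \<le> rademacher c A two_point"
      using lower by (simp add: field_simps)
    have "nonneg_on (12 / 5) (21 / 5) (padd (padd [111 / 125, 2713 / 10000, - 207 / 50000]
        (psmult (- 297 / 1000 / (9 / 5)) [21 / 5 * (189 / 625) - 12 / 5 * (123 / 1000), 123 / 1000 - 189 / 625]))
        [- ((61 / 50)\<^sup>2 / 3 + 1 / (3 * (61 / 50))), - (1 / (3 * (61 / 50)))])"
      by (simp add: cert_simps)
    from nonneg_onD[OF this, of w] show ?thesis
      using True assms lower' target_le_tangent[of "61 / 50"] by (simp add: eval_nat_numeral field_simps)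
  next
    case False
    have "exp (- w / 2) \<le> ((10 - w) * (123 / 1000) + (w - 21 / 5) * (17 / 2500)) / (10 - 21 / 5)"
      using exp_bounds False assms by (intro exp_secant) auto
    then have lower': "111 / 125 + 2713 / 10000 * w - 207 / 50000 * w\<^sup>2
        - 297 / 1000 * (((10 - w) * (123 / 1000) + (w - 21 / 5) * (17 / 2500)) / (29 / 5)) \<le> rademacher c A two_point"
      using lower by (simp add: field_simps)
    have "nonneg_on (21 / 5) 10 (padd (padd [111 / 125, 2713 / 10000, - 207 / 50000]
        (psmult (- 297 / 1000 / (29 / 5)) [10 * (123 / 1000) - 21 / 5 * (17 / 2500), 17 / 2500 - 123 / 1000]))
        [- ((38 / 25)\<^sup>2 / 3 + 1 / (3 * (38 / 25))), - (1 / (3 * (38 / 25)))])"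
      by (simp add: cert_simps)
    from nonneg_onD[OF this, of w] show ?thesis
      using False assms lower' target_le_tangent[of "38 / 25"] by (simp add: eval_nat_numeral field_simps)
  qed
qed

lemma two_point_bound:
  assumes "w \<le> 10"
  shows "((1 + w) / 2) powr (2 / 3) \<le> rademacher c A two_point"
proof -
  consider "w \<le> 6 / 5" | "6 / 5 \<le> w" "w \<le> 8 / 5" | "8 / 5 \<le> w" "w \<le> 12 / 5" | "12 / 5 \<le> w" by linarith
  then show ?thesis
  proof cases
    case 3
    show ?thesis
    proof (cases "\<forall>i\<in>A. \<bar>c i\<bar> \<le> 22 / 25")
      case True
      then show ?thesis using 3 two_point_bound_flat by blast
    next
      case False
      then obtain j where "j \<in> A" "22 / 25 \<le> \<bar>c j\<bar>" by force
      then show ?thesis using 3 two_point_bound_spiked by blast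
    qed
  qed (use two_point_bound_low two_point_bound_mid two_point_bound_gauss assms in blast)+
qed

end

text \<open>The condition on the coefficients keeps $5c_i/2$ below $157/100$, so both cosines have at most their
Gaussian averages.\<close>
lemma spread_bound:
  fixes c :: "'a \<Rightarrow> real"
  assumes "finite A" and "(\<Sum>i\<in>A. c i ^ 2) = 4" and "\<And>i. i \<in> A \<Longrightarrow> 11 * c i ^ 2 \<le> 4"
  shows "2 \<le> rademacher c A (\<lambda>s. \<bar>s\<bar> powr (4 / 3))"
proof -
  have c: "\<bar>c i\<bar> \<le> 157 / 250" if "i \<in> A" for i
    using assms(3)[OF that] abs_le_square_iff[of "c i" "157 / 250"] by (simp add: power2_eq_square)
  have "rademacher c A (\<lambda>s. cos (5 / 4 * s)) \<le> exp (- (5 / 4)\<^sup>2 * (\<Sum>i\<in>A. c i ^ 2) / 2)"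
    and "rademacher c A (\<lambda>s. cos (5 / 2 * s)) \<le> exp (- (5 / 2)\<^sup>2 * (\<Sum>i\<in>A. c i ^ 2) / 2)"
    using c assms(1) by (intro rademacher_cos_bounds; fastforce simp: abs_mult)+
  then have "rademacher c A (\<lambda>s. cos (5 / 4 * s)) \<le> 1 / 20" and "rademacher c A (\<lambda>s. cos (5 / 2 * s)) \<le> 1 / 1000"
    unfolding assms(2) using exp_bounds(4,5) by (meson order_trans)+
  moreover have "0 \<le> (\<Sum>i\<in>A. c i ^ 4)"
    by (simp add: sum_nonneg)
  moreover have "29 / 50 + 201 / 500 * 4 - 81 / 25000 * (48 - 2 * (\<Sum>i\<in>A. c i ^ 4))
      - 117 / 250 * rademacher c A (\<lambda>s. cos (5 / 4 * s)) - 113 / 1000 * rademacher c A (\<lambda>s. cos (5 / 2 * s))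
      = rademacher c A (\<lambda>s. 29 / 50 + 201 / 500 * s\<^sup>2 - 81 / 25000 * s ^ 4 - 117 / 250 * cos (5 / 4 * s) - 113 / 1000 * cos (5 / 2 * s))"
    using assms(1,2) unfolding rademacher_diff rademacher_add rademacher_mult by (simp add: rademacher_moment2 rademacher_moment4)
  moreover have "rademacher c A (\<lambda>s. 29 / 50 + 201 / 500 * s\<^sup>2 - 81 / 25000 * s ^ 4 - 117 / 250 * cos (5 / 4 * s) - 113 / 1000 * cos (5 / 2 * s))
      \<le> rademacher c A (\<lambda>s. \<bar>s\<bar> powr (4 / 3))"
    using powr_ge_spread by (intro rademacher_mono)
  ultimately show ?thesis by (simp add: field_simps)
qed

text \<open>Khinchine's inequality for the exponent $4/3$ with the best constant: equality holds for two equal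
coefficients.\<close>
theorem khinchine_four_thirds:
  fixes c :: "'a \<Rightarrow> real"
  assumes "finite A"
  shows "(\<Sum>i\<in>A. c i ^ 2) powr (2 / 3) \<le> 2 powr (1 / 3) * rademacher c A (\<lambda>s. \<bar>s\<bar> powr (4 / 3))"
proof (cases "\<forall>i\<in>A. c i = 0")
  case True
  then show ?thesis using assms by (simp add: rademacher_def sign_avg_nonneg)
next
  case False
  then have "A \<noteq> {}" by auto
  then have "Max ((\<lambda>i. \<bar>c i\<bar>) ` A) \<in> (\<lambda>i. \<bar>c i\<bar>) ` A"
    using assms by (intro Max_in) auto
  then obtain x where x: "x \<in> A" and "Max ((\<lambda>i. \<bar>c i\<bar>) ` A) = \<bar>c x\<bar>" by auto
  then have max: "\<bar>c i\<bar> \<le> \<bar>c x\<bar>" if "i \<in> A" for i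
    using assms that Max_ge[of "(\<lambda>i. \<bar>c i\<bar>) ` A" "\<bar>c i\<bar>"] by simp
  \<comment> \<open>the statement is homogeneous in $c$; $S$ is the variance and $m$ the largest coefficient\<close>
  define m where "m = \<bar>c x\<bar>"
  have m: "0 < m"
    using False max unfolding m_def by fastforce
  define S where "S = (\<Sum>i\<in>A. c i ^ 2)"
  have S: "0 < S"
    unfolding S_def using assms x m by (intro sum_pos2[of A x]) (auto simp: m_def)
  have scaled: "rademacher (\<lambda>i. r * c i) A (\<lambda>s. \<bar>s\<bar> powr (4 / 3)) = r powr (4 / 3) * rademacher c A (\<lambda>s. \<bar>s\<bar> powr (4 / 3))"
    if "0 < r" for r
    unfolding rademacher_scale using that by (simp add: abs_mult powr_mult rademacher_mult)
  show ?thesis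
  proof (cases "S \<le> 11 * m\<^sup>2")
    case True
    \<comment> \<open>a dominating coefficient: split it off, so that the other ones have variance $w = S/m^2 - 1 \le 10$\<close>
    define b where "b i = 1 / m * c i" for i
    define B where "B = A - {x}"
    have B: "finite B" "x \<notin> B" "A = insert x B" using assms x by (auto simp: B_def)
    interpret small_coefficients b B "\<Sum>i\<in>B. b i ^ 2" "\<Sum>i\<in>B. b i ^ 4" "\<Sum>i\<in>B. b i ^ 6"
      using B max m by unfold_locales (auto simp: b_def m_def)
    have bx: "b x = 1 \<or> b x = - 1" using m by (auto simp: b_def m_def abs_if)
    have "S / m\<^sup>2 = (\<Sum>i\<in>A. b i ^ 2)"
      by (simp add: S_def b_def power_divide sum_divide_distrib)
    also have "\<dots> = 1 + (\<Sum>i\<in>B. b i ^ 2)"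
      using B bx by auto
    finally have w: "S / m\<^sup>2 = 1 + (\<Sum>i\<in>B. b i ^ 2)" .
    moreover have "S / m\<^sup>2 \<le> 11" using True m by (simp add: divide_le_eq)
    ultimately have le: "(S / m\<^sup>2 / 2) powr (2 / 3) \<le> rademacher b B two_point"
      using two_point_bound by simp
    let ?h = "(1 / 2 :: real) powr (4 / 3)" and ?R = "rademacher c A (\<lambda>s. \<bar>s\<bar> powr (4 / 3))"
    have tp: "two_point s = ?h * 2 * ((\<bar>s - b x\<bar> powr (4 / 3) + \<bar>s + b x\<bar> powr (4 / 3)) / 2)" for s
    proof -
      have "two_point s = ?h * \<bar>1 + s\<bar> powr (4 / 3) + ?h * \<bar>1 - s\<bar> powr (4 / 3)"
        unfolding two_point_def by (simp flip: powr_mult)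
      moreover have "\<bar>1 + s\<bar> powr (4 / 3) + \<bar>1 - s\<bar> powr (4 / 3) = \<bar>s - b x\<bar> powr (4 / 3) + \<bar>s + b x\<bar> powr (4 / 3)"
        using bx by (auto simp: abs_minus_commute add.commute)
      ultimately show ?thesis by (simp flip: distrib_left)
    qed
    have "rademacher b B two_point = rademacher b B (\<lambda>s. ?h * 2 * ((\<bar>s - b x\<bar> powr (4 / 3) + \<bar>s + b x\<bar> powr (4 / 3)) / 2))"
      by (rule arg_cong[where f = "rademacher b B"], rule ext) (rule tp)
    also have "\<dots> = ?h * 2 * rademacher b (insert x B) (\<lambda>s. \<bar>s\<bar> powr (4 / 3))"
      by (simp only: rademacher_mult rademacher_insert[OF B(1,2)])
    also have "rademacher b (insert x B) (\<lambda>s. \<bar>s\<bar> powr (4 / 3)) = (1 / m) powr (4 / 3) * ?R"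
      using scaled[of "1 / m"] m by (simp only: B(3)[symmetric] b_def[abs_def] zero_less_divide_1_iff)
    finally have "(S / m\<^sup>2 / 2) powr (2 / 3) \<le> ?h * 2 * ((1 / m) powr (4 / 3) * ?R)"
      using le by (simp only:)
    moreover have "(S / m\<^sup>2 / 2) powr (2 / 3) = (1 / m) powr (4 / 3) * (S powr (2 / 3) * (1 / 2) powr (2 / 3))"
    proof -
      have "(m\<^sup>2) powr (2 / 3) = m powr (4 / 3)"
        using m by (simp add: powr_powr flip: powr_numeral)
      then show ?thesis using m S by (simp add: powr_divide powr_mult)
    qed
    ultimately have "(1 / m) powr (4 / 3) * (S powr (2 / 3) * (1 / 2) powr (2 / 3)) \<le> (1 / m) powr (4 / 3) * (?h * 2 * ?R)"
      by (simp only: mult_ac)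
    then have "S powr (2 / 3) * (1 / 2) powr (2 / 3) \<le> ?h * 2 * ?R"
      using m mult_le_cancel_left_pos[of "(1 / m) powr (4 / 3)"] by (simp only: powr_gt_zero zero_less_divide_1_iff) simp
    then have "2 powr (2 / 3) * (S powr (2 / 3) * (1 / 2) powr (2 / 3)) \<le> 2 powr (2 / 3) * (?h * 2 * ?R)"
      by (intro mult_left_mono) auto
    also have "2 powr (2 / 3) * (S powr (2 / 3) * (1 / 2) powr (2 / 3)) = S powr (2 / 3)"
      by (simp add: powr_divide)
    also have "2 powr (2 / 3) * (?h * 2 * ?R) = (2 powr (2 / 3) * 2 powr 1 / 2 powr (4 / 3)) * ?R"
      by (simp add: powr_divide)
    also have "2 powr (2 / 3) * 2 powr 1 / 2 powr (4 / 3) = (2 :: real) powr (1 / 3)"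
      unfolding powr_add[symmetric] powr_diff[symmetric] by simp
    finally show ?thesis by (simp add: S_def)
  next
    case False
    \<comment> \<open>no dominating coefficient: normalize the variance to $4$\<close>
    define r where "r = 2 / sqrt S"
    have r: "0 < r" "r\<^sup>2 = 4 / S" using S by (simp_all add: r_def power_divide)
    have "2 \<le> rademacher (\<lambda>i. r * c i) A (\<lambda>s. \<bar>s\<bar> powr (4 / 3))"
    proof (rule spread_bound[OF assms])
      show "(\<Sum>i\<in>A. (r * c i)\<^sup>2) = 4"
        using S unfolding power_mult_distrib sum_distrib_left[symmetric] r by (simp flip: S_def)
      fix i assume "i \<in> A"
      then have "c i ^ 2 \<le> m\<^sup>2" using max[of i] by (simp add: m_def abs_le_square_iff)
      then have "11 * c i ^ 2 \<le> S" using False by linarith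
      then show "11 * (r * c i)\<^sup>2 \<le> 4"
        unfolding power_mult_distrib r using S by (simp add: divide_le_eq)
    qed
    also have "\<dots> = r powr (4 / 3) * rademacher c A (\<lambda>s. \<bar>s\<bar> powr (4 / 3))"
      using r by (intro scaled)
    also have "r powr (4 / 3) = 2 powr (4 / 3) / S powr (2 / 3)"
      using S by (simp add: r_def powr_divide powr_half_sqrt[symmetric] powr_powr)
    finally have "2 * S powr (2 / 3) \<le> 2 powr (4 / 3) * rademacher c A (\<lambda>s. \<bar>s\<bar> powr (4 / 3))"
      using S by (simp add: field_simps)
    also have "(2 :: real) powr (4 / 3) = 2 * 2 powr (1 / 3)"
      using powr_add[of "2 :: real" 1 "1 / 3"] by simp
    finally show ?thesis by (simp add: S_def)
  qed
qed

section \<open>Mixed norms\<close>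

definition lp_norm :: "real \<Rightarrow> 'a set \<Rightarrow> ('a \<Rightarrow> real) \<Rightarrow> real" where
  "lp_norm q I f = (\<Sum>i\<in>I. \<bar>f i\<bar> powr q) powr (1 / q)"

lemma lp_norm_nonneg [simp]: "0 \<le> lp_norm q I f"
  by (simp add: lp_norm_def)

lemma abs_lp_norm [simp]: "\<bar>lp_norm q I f\<bar> = lp_norm q I f"
  by simp

lemma lp_norm_powr: "q \<noteq> 0 \<Longrightarrow> lp_norm q I f powr q = (\<Sum>i\<in>I. \<bar>f i\<bar> powr q)"
  by (simp add: lp_norm_def powr_powr sum_nonneg)

lemma lp_norm_eq_0_imp: "finite I \<Longrightarrow> lp_norm q I f = 0 \<Longrightarrow> i \<in> I \<Longrightarrow> f i = 0"
  by (auto simp: lp_norm_def sum_nonneg_eq_0_iff)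

lemma lp_norm_1: "lp_norm 1 I f = (\<Sum>i\<in>I. \<bar>f i\<bar>)"
  by (simp add: lp_norm_def sum_nonneg)

lemma lp_norm_2: "lp_norm 2 I f = L2_set f I"
  by (simp add: lp_norm_def L2_set_def powr_half_sqrt sum_nonneg)

lemma lp_norm_le:
  assumes "0 < q" and "0 \<le> C" and "(\<Sum>i\<in>I. \<bar>f i\<bar> powr q) \<le> C powr q"
  shows "lp_norm q I f \<le> C"
proof -
  have "lp_norm q I f \<le> (C powr q) powr (1 / q)"
    unfolding lp_norm_def using assms by (intro powr_mono2 sum_nonneg) auto
  then show ?thesis using assms by (simp add: powr_powr)
qed

text \<open>Hoelder's inequality in interpolation form, from Young's inequality after normalizing $g$ and $h$.
The convention $0^0 = 0$ for real powers makes the end points $u = 0$ and $v = 0$ admissible: the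
hypothesis then forces $f$ to vanish where $g$ or $h$ does.\<close>
lemma lp_norm_interpolation:
  assumes "finite I" and "0 < p" "0 < p1" "0 < p2" and "0 \<le> u" "0 \<le> v" "u + v = 1"
    and exponents: "1 / p = u / p1 + v / p2"
    and le: "\<And>i. i \<in> I \<Longrightarrow> \<bar>f i\<bar> \<le> \<bar>g i\<bar> powr u * \<bar>h i\<bar> powr v"
  shows "lp_norm p I f \<le> lp_norm p1 I g powr u * lp_norm p2 I h powr v"
proof (cases "lp_norm p1 I g = 0 \<or> lp_norm p2 I h = 0")
  case True
  then have "f i = 0" if "i \<in> I" for i
    using le[OF that] lp_norm_eq_0_imp[OF assms(1) _ that] by force
  then have "lp_norm p I f = 0" by (simp add: lp_norm_def)
  then show ?thesis by simp
next
  case False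
  define G where "G = lp_norm p1 I g"
  define H where "H = lp_norm p2 I h"
  have pos: "0 < G" "0 < H"
    using False by (simp_all add: G_def H_def less_le)
  define \<alpha> where "\<alpha> = p * u / p1"
  define \<beta> where "\<beta> = p * v / p2"
  have "\<alpha> + \<beta> = p * (1 / p)"
    unfolding exponents by (simp add: \<alpha>_def \<beta>_def distrib_left)
  then have weights: "0 \<le> \<alpha>" "0 \<le> \<beta>" "\<alpha> + \<beta> = 1"
    using assms(2-6) by (simp_all add: \<alpha>_def \<beta>_def)
  let ?K = "(G powr u * H powr v) powr p"
  have "\<bar>f i\<bar> powr p \<le> ?K * (\<alpha> * (\<bar>g i\<bar> powr p1 / G powr p1) + \<beta> * (\<bar>h i\<bar> powr p2 / H powr p2))"
    if i: "i \<in> I" for i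
  proof -
    let ?x = "(\<bar>g i\<bar> / G) powr p1" and ?y = "(\<bar>h i\<bar> / H) powr p2"
    have "\<bar>f i\<bar> powr p \<le> (\<bar>g i\<bar> powr u * \<bar>h i\<bar> powr v) powr p"
      using le[OF i] assms(2) by (intro powr_mono2) auto
    also have "\<dots> = ?K * (?x powr \<alpha> * ?y powr \<beta>)"
      using pos assms(2-6) by (simp add: powr_mult powr_divide powr_powr \<alpha>_def \<beta>_def mult.commute[of p])
    also have "?x powr \<alpha> * ?y powr \<beta> \<le> \<alpha> * ?x + \<beta> * ?y"
    proof (cases "?x = 0 \<or> ?y = 0")
      case False
      then show ?thesis using weights by (intro Youngs_inequality_0) (auto simp: less_le)
    qed (use weights in auto)
    finally show ?thesis using pos by (simp add: powr_divide mult_left_mono)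
  qed
  then have "(\<Sum>i\<in>I. \<bar>f i\<bar> powr p)
      \<le> (\<Sum>i\<in>I. ?K * (\<alpha> * (\<bar>g i\<bar> powr p1 / G powr p1) + \<beta> * (\<bar>h i\<bar> powr p2 / H powr p2)))"
    by (intro sum_mono)
  also have "\<dots> = ?K * (\<alpha> * ((\<Sum>i\<in>I. \<bar>g i\<bar> powr p1) / G powr p1) + \<beta> * ((\<Sum>i\<in>I. \<bar>h i\<bar> powr p2) / H powr p2))"
    by (simp add: sum_distrib_left[symmetric] sum.distrib sum_divide_distrib[symmetric])
  also have "\<dots> = ?K * (\<alpha> * (G powr p1 / G powr p1) + \<beta> * (H powr p2 / H powr p2))"
    using assms(3,4) by (simp add: G_def H_def lp_norm_powr)
  also have "\<dots> = ?K" using pos weights by simp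
  finally have "(\<Sum>i\<in>I. \<bar>f i\<bar> powr p) \<le> ?K" .
  then show ?thesis
    using assms(2) unfolding G_def H_def by (intro lp_norm_le) auto
qed

lemma L2_set_sum_le:
  assumes "finite X"
  shows "L2_set (\<lambda>j. \<Sum>b\<in>X. f j b) J \<le> (\<Sum>b\<in>X. L2_set (\<lambda>j. f j b) J)"
  using assms
proof (induction X rule: finite_induct)
  case (insert b X)
  have "L2_set (\<lambda>j. f j b + (\<Sum>b\<in>X. f j b)) J \<le> L2_set (\<lambda>j. f j b) J + L2_set (\<lambda>j. \<Sum>b\<in>X. f j b) J"
    by (rule L2_set_triangle_ineq)
  then show ?case using insert by simp
qed (simp add: L2_set_def)

lemma L2_set_sign_avg_le:
  assumes "finite A"
  shows "L2_set (\<lambda>j. sign_avg A (F j)) J \<le> sign_avg A (\<lambda>B. L2_set (\<lambda>j. F j B) J)"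
proof -
  have "L2_set (\<lambda>j. sign_avg A (F j)) J = (1 / 2 ^ card A) * L2_set (\<lambda>j. \<Sum>B\<in>Pow A. F j B) J"
    by (subst L2_set_right_distrib) (simp_all add: sign_avg_def)
  also have "\<dots> \<le> (1 / 2 ^ card A) * (\<Sum>B\<in>Pow A. L2_set (\<lambda>j. F j B) J)"
    using assms by (intro mult_left_mono L2_set_sum_le) auto
  finally show ?thesis by (simp add: sign_avg_def)
qed

text \<open>The triangle inequality in $\ell_{3/2}$.  Write $b_j = \sum_k c_{jk}$ and
$S = \sum_j b_j^{3/2} = \sum_k \sum_j c_{jk} b_j^{1/2}$; Hoelder's inequality with exponents $3/2$ and
$3$ bounds the inner sums by $S^{1/3}$ times the norm of the $k$-th summand.\<close>
lemma minkowski_three_halves: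
  fixes c :: "'a \<Rightarrow> 'b \<Rightarrow> real"
  assumes "finite J" and "finite K" and c: "\<And>j k. 0 \<le> c j k"
  shows "(\<Sum>j\<in>J. (\<Sum>k\<in>K. c j k) powr (3 / 2)) powr (2 / 3)
    \<le> (\<Sum>k\<in>K. (\<Sum>j\<in>J. c j k powr (3 / 2)) powr (2 / 3))"
proof -
  define b where "b j = (\<Sum>k\<in>K. c j k)" for j
  have b: "0 \<le> b j" for j unfolding b_def by (intro sum_nonneg) (rule c)
  define S where "S = (\<Sum>j\<in>J. b j powr (3 / 2))"
  let ?n = "\<lambda>k. (\<Sum>j\<in>J. c j k powr (3 / 2)) powr (2 / 3)"
  have S: "0 \<le> S" unfolding S_def by (intro sum_nonneg) auto
  have holder: "(\<Sum>j\<in>J. c j k * b j powr (1 / 2)) \<le> S powr (1 / 3) * ?n k" for k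
  proof -
    have "lp_norm 1 J (\<lambda>j. c j k * b j powr (1 / 2))
        \<le> lp_norm 1 J (\<lambda>j. b j powr (3 / 2)) powr (1 / 3) * lp_norm 1 J (\<lambda>j. c j k powr (3 / 2)) powr (2 / 3)"
      by (rule lp_norm_interpolation) (use assms(1) c b in \<open>auto simp: powr_powr abs_mult\<close>)
    then show ?thesis using c b by (simp add: lp_norm_1 S_def abs_mult)
  qed
  have "S = (\<Sum>j\<in>J. (\<Sum>k\<in>K. c j k * b j powr (1 / 2)))"
    unfolding S_def
  proof (rule sum.cong)
    fix j
    have "b j powr (3 / 2) = b j * b j powr (1 / 2)"
      using powr_mult_base[OF b, of j "1 / 2"] by simp
    then show "b j powr (3 / 2) = (\<Sum>k\<in>K. c j k * b j powr (1 / 2))"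
      by (simp add: b_def sum_distrib_right)
  qed simp
  also have "\<dots> = (\<Sum>k\<in>K. (\<Sum>j\<in>J. c j k * b j powr (1 / 2)))"
    by (rule sum.swap)
  also have "\<dots> \<le> (\<Sum>k\<in>K. S powr (1 / 3) * ?n k)"
    by (intro sum_mono holder)
  finally have *: "S \<le> S powr (1 / 3) * (\<Sum>k\<in>K. ?n k)"
    by (simp add: sum_distrib_left)
  have "S powr (2 / 3) \<le> (\<Sum>k\<in>K. ?n k)"
  proof (cases "S = 0")
    case True
    then show ?thesis by (simp add: sum_nonneg)
  next
    case False
    then have pos: "0 < S powr (1 / 3)" by simp
    have "S powr (1 / 3) * S powr (2 / 3) = S"
      using S by (simp flip: powr_add)
    then have "S powr (1 / 3) * S powr (2 / 3) \<le> S powr (1 / 3) * (\<Sum>k\<in>K. ?n k)"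
      using * by simp
    then show ?thesis using pos by (simp only: mult_le_cancel_left_pos)
  qed
  then show ?thesis by (simp add: S_def b_def)
qed

text \<open>For $X = \sum_i \varepsilon_i c_i$ one has
$\|X\|_2 \le 2^{1/4} \|X\|_{4/3} \le 2^{1/4} \|X\|_1^{1/2} \|X\|_2^{1/2}$, hence
$\|X\|_2 \le \sqrt 2\,\|X\|_1$.\<close>
lemma khinchine_one:
  fixes c :: "'a \<Rightarrow> real"
  assumes "finite A"
  shows "L2_set c A \<le> sqrt 2 * rademacher c A abs"
proof -
  define S where "S = (\<Sum>i\<in>A. c i ^ 2)"
  define R where "R = rademacher c A (\<lambda>s. \<bar>s\<bar> powr (4 / 3))"
  define R1 where "R1 = rademacher c A abs"
  define n :: real where "n = 2 ^ card A"
  have n: "0 < n" by (simp add: n_def)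
  have nonneg: "0 \<le> S" "0 \<le> R" "0 \<le> R1"
    by (auto simp: S_def R_def R1_def rademacher_def intro!: sum_nonneg sign_avg_nonneg)
  have sums: "(\<Sum>B\<in>Pow A. f (signed_sum c A B)) = n * rademacher c A f" for f
    by (simp add: rademacher_def sign_avg_def n_def)
  have "lp_norm (4 / 3) (Pow A) (signed_sum c A)
      \<le> lp_norm 1 (Pow A) (signed_sum c A) powr (1 / 2) * lp_norm 2 (Pow A) (signed_sum c A) powr (1 / 2)"
    by (rule lp_norm_interpolation) (use assms in \<open>auto simp: simp flip: powr_add\<close>)
  moreover have "lp_norm (4 / 3) (Pow A) (signed_sum c A) = (n * R) powr (3 / 4)"
    using sums[of "\<lambda>s. \<bar>s\<bar> powr (4 / 3)"] by (simp add: lp_norm_def R_def)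
  moreover have "lp_norm 1 (Pow A) (signed_sum c A) = n * R1"
    using sums[of abs] by (simp add: lp_norm_1 R1_def)
  moreover have "lp_norm 2 (Pow A) (signed_sum c A) = (n * S) powr (1 / 2)"
    using sums[of "\<lambda>s. s ^ 2"] rademacher_moment2[OF assms, of c] by (simp add: lp_norm_def S_def)
  ultimately have "n powr (3 / 4) * R powr (3 / 4)
      \<le> (n powr (1 / 2) * n powr (1 / 4)) * (R1 powr (1 / 2) * S powr (1 / 4))"
    using n nonneg by (simp add: powr_mult powr_powr mult_ac)
  also have "n powr (1 / 2) * n powr (1 / 4) = n powr (3 / 4)"
    by (simp flip: powr_add)
  finally have R: "R powr (3 / 4) \<le> R1 powr (1 / 2) * S powr (1 / 4)"
    using n by simp
  have "S powr (2 / 3) \<le> 2 powr (1 / 3) * R"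
    using khinchine_four_thirds[OF assms, of c] by (simp add: S_def R_def)
  then have "(S powr (2 / 3)) powr (3 / 4) \<le> (2 powr (1 / 3) * R) powr (3 / 4)"
    by (intro powr_mono2) auto
  then have "S powr (1 / 2) \<le> 2 powr (1 / 4) * R powr (3 / 4)"
    using nonneg by (simp add: powr_mult powr_powr)
  also have "\<dots> \<le> 2 powr (1 / 4) * (R1 powr (1 / 2) * S powr (1 / 4))"
    by (intro mult_left_mono R) auto
  finally have le: "S powr (1 / 4) * S powr (1 / 4) \<le> (2 powr (1 / 4) * R1 powr (1 / 2)) * S powr (1 / 4)"
    by (simp add: mult_ac flip: powr_add)
  have "S powr (1 / 4) \<le> 2 powr (1 / 4) * R1 powr (1 / 2)"
  proof (cases "S = 0")
    case False
    then have "0 < S powr (1 / 4)" by simp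
    then show ?thesis using le by (simp only: mult_le_cancel_right_pos)
  qed simp
  then have "(S powr (1 / 4)) powr 2 \<le> (2 powr (1 / 4) * R1 powr (1 / 2)) powr 2"
    by (intro powr_mono2) auto
  then have "S powr (1 / 2) \<le> 2 powr (1 / 2) * R1"
    using nonneg by (simp add: powr_mult powr_powr del: powr_numeral)
  then show ?thesis
    using nonneg by (simp add: powr_half_sqrt L2_set_def S_def R1_def)
qed

section \<open>Mixed inequalities for bounded arrays\<close>

lemma sum_abs_eq_signed_sum: "(\<Sum>i\<in>I. \<bar>u i\<bar>) = signed_sum u I {i. 0 \<le> u i}"
  unfolding signed_sum_def by (intro sum.cong) auto

lemma signed_sum_swap:
  "signed_sum (\<lambda>i. signed_sum (b i) J C) I B = signed_sum (\<lambda>j. signed_sum (\<lambda>i. b i j) I B) J C"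
proof -
  have eq: "signed_sum c A B = (\<Sum>i\<in>A. (if i \<in> B then 1 else - 1) * c i)" for c :: "'c \<Rightarrow> real" and A B
    unfolding signed_sum_def by (intro sum.cong) auto
  show ?thesis
    unfolding eq sum_distrib_left by (subst sum.swap) (simp only: mult.left_commute)
qed

text \<open>The array is the coefficient array of a form bounded by $M$ on all sign vectors, the extreme
points of the unit ball of a finite-dimensional $\ell_\infty$.\<close>
definition bounded2 :: "real \<Rightarrow> 'a set \<Rightarrow> 'b set \<Rightarrow> ('a \<Rightarrow> 'b \<Rightarrow> real) \<Rightarrow> bool" where
  "bounded2 M I J b \<longleftrightarrow> (\<forall>B C. \<bar>signed_sum (\<lambda>i. signed_sum (b i) J C) I B\<bar> \<le> M)"

definition bounded3 :: "real \<Rightarrow> 'a set \<Rightarrow> 'b set \<Rightarrow> 'c set \<Rightarrow> ('a \<Rightarrow> 'b \<Rightarrow> 'c \<Rightarrow> real) \<Rightarrow> bool" where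
  "bounded3 M I J K a \<longleftrightarrow> (\<forall>D. bounded2 M I J (\<lambda>i j. signed_sum (a i j) K D))"

lemma bounded2_swap: "bounded2 M I J b \<Longrightarrow> bounded2 M J I (\<lambda>j i. b i j)"
  unfolding bounded2_def by (subst signed_sum_swap) blast

lemma bounded2_nonneg: "bounded2 M I J b \<Longrightarrow> 0 \<le> M"
  unfolding bounded2_def by (meson abs_ge_zero order_trans)

lemma bounded3_nonneg: "bounded3 M I J K a \<Longrightarrow> 0 \<le> M"
  unfolding bounded3_def using bounded2_nonneg by blast

lemma bounded3_swap:
  assumes "bounded3 M I J K a"
  shows "bounded3 M I K J (\<lambda>i k j. a i j k)"
proof -
  have "signed_sum (\<lambda>k. signed_sum (\<lambda>j. a i j k) J D) K C = signed_sum (\<lambda>j. signed_sum (a i j) K C) J D" for i C D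
    by (rule signed_sum_swap)
  then show ?thesis
    using assms by (simp add: bounded3_def bounded2_def)
qed

text \<open>Khinchine's inequality in $j$ for each $i$; for fixed signs in $j$ the sum over $i$ of the absolute
values is a value of the form, with suitable signs in $i$.\<close>
lemma littlewood_1_2:
  assumes "finite I" "finite J" and "bounded2 M I J b"
  shows "lp_norm 1 I (\<lambda>i. lp_norm 2 J (b i)) \<le> sqrt 2 * M"
proof -
  have "lp_norm 1 I (\<lambda>i. lp_norm 2 J (b i)) \<le> (\<Sum>i\<in>I. sqrt 2 * rademacher (b i) J abs)"
    unfolding lp_norm_1 lp_norm_2 using khinchine_one[OF assms(2)] by (intro sum_mono) auto
  also have "\<dots> = sqrt 2 * sign_avg J (\<lambda>C. \<Sum>i\<in>I. \<bar>signed_sum (b i) J C\<bar>)"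
    using assms by (simp add: sign_avg_sum rademacher_def sum_distrib_left)
  also have "\<dots> \<le> sqrt 2 * M"
  proof (intro mult_left_mono sign_avg_le)
    show "(\<Sum>i\<in>I. \<bar>signed_sum (b i) J C\<bar>) \<le> M" for C
      using assms(3) unfolding sum_abs_eq_signed_sum bounded2_def by (meson abs_le_D1)
  qed (use assms in auto)
  finally show ?thesis .
qed

text \<open>Littlewood's $4/3$ inequality: interpolation between the exponents $(1,2)$ and $(2,1)$, the latter
being reduced to the former with the variables exchanged by the triangle inequality in $\ell_2$.\<close>
lemma littlewood_four_thirds:
  assumes "finite I" "finite J" and "bounded2 M I J b"
  shows "lp_norm (4 / 3) I (\<lambda>i. lp_norm (4 / 3) J (b i)) \<le> sqrt 2 * M"
proof -
  have "lp_norm (4 / 3) I (\<lambda>i. lp_norm (4 / 3) J (b i))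
      \<le> lp_norm 1 I (\<lambda>i. lp_norm 2 J (b i)) powr (1 / 2) * lp_norm 2 I (\<lambda>i. lp_norm 1 J (b i)) powr (1 / 2)"
  proof (rule lp_norm_interpolation)
    fix i
    have "lp_norm (4 / 3) J (b i) \<le> lp_norm 2 J (b i) powr (1 / 2) * lp_norm 1 J (b i) powr (1 / 2)"
      by (rule lp_norm_interpolation) (use assms in \<open>auto simp flip: powr_add\<close>)
    then show "\<bar>lp_norm (4 / 3) J (b i)\<bar> \<le> \<bar>lp_norm 2 J (b i)\<bar> powr (1 / 2) * \<bar>lp_norm 1 J (b i)\<bar> powr (1 / 2)"
      by simp
  qed (use assms in auto)
  also have "\<dots> \<le> (sqrt 2 * M) powr (1 / 2) * (sqrt 2 * M) powr (1 / 2)"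
  proof (intro mult_mono powr_mono2)
    have "lp_norm 2 I (\<lambda>i. lp_norm 1 J (b i)) = L2_set (\<lambda>i. \<Sum>j\<in>J. \<bar>b i j\<bar>) I"
      by (simp add: lp_norm_1 lp_norm_2)
    also have "\<dots> \<le> (\<Sum>j\<in>J. L2_set (\<lambda>i. \<bar>b i j\<bar>) I)"
      using assms(2) by (rule L2_set_sum_le)
    also have "\<dots> = lp_norm 1 J (\<lambda>j. lp_norm 2 I (\<lambda>i. b i j))"
      by (simp add: lp_norm_1 lp_norm_2 L2_set_def sum_nonneg)
    also have "\<dots> \<le> sqrt 2 * M"
      by (rule littlewood_1_2[OF assms(2,1) bounded2_swap[OF assms(3)]])
    finally show "lp_norm 2 I (\<lambda>i. lp_norm 1 J (b i)) \<le> sqrt 2 * M" .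
  qed (use littlewood_1_2[OF assms] in auto)
  also have "\<dots> = sqrt 2 * M"
    using bounded2_nonneg[OF assms(3)] by (simp flip: powr_add)
  finally show ?thesis .
qed

text \<open>Khinchine's inequality in the last variable, the triangle inequality in $\ell_2$ to take the average
out of the norm in $j$, and \<open>littlewood_1_2\<close> for each choice of signs in the last variable.\<close>
lemma corner_1_2_2:
  assumes "finite I" "finite J" "finite K" and "bounded3 M I J K a"
  shows "lp_norm 1 I (\<lambda>i. lp_norm 2 J (\<lambda>j. lp_norm 2 K (a i j))) \<le> 2 * M"
proof -
  let ?t = "\<lambda>D i j. signed_sum (a i j) K D"
  have "L2_set (\<lambda>j. L2_set (a i j) K) J \<le> sqrt 2 * sign_avg K (\<lambda>D. L2_set (?t D i) J)" for i
  proof -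
    have "L2_set (\<lambda>j. L2_set (a i j) K) J \<le> L2_set (\<lambda>j. sqrt 2 * sign_avg K (\<lambda>D. \<bar>?t D i j\<bar>)) J"
      using khinchine_one[OF assms(3)] by (intro L2_set_mono) (auto simp: rademacher_def)
    also have "\<dots> = sqrt 2 * L2_set (\<lambda>j. sign_avg K (\<lambda>D. \<bar>?t D i j\<bar>)) J"
      by (simp add: L2_set_right_distrib)
    also have "\<dots> \<le> sqrt 2 * sign_avg K (\<lambda>D. L2_set (\<lambda>j. \<bar>?t D i j\<bar>) J)"
      using assms(3) by (intro mult_left_mono L2_set_sign_avg_le) auto
    finally show ?thesis by (simp add: L2_set_def)
  qed
  then have "lp_norm 1 I (\<lambda>i. lp_norm 2 J (\<lambda>j. lp_norm 2 K (a i j))) \<le> (\<Sum>i\<in>I. sqrt 2 * sign_avg K (\<lambda>D. L2_set (?t D i) J))"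
    unfolding lp_norm_1 lp_norm_2 by (intro sum_mono) auto
  also have "\<dots> = sqrt 2 * sign_avg K (\<lambda>D. \<Sum>i\<in>I. L2_set (?t D i) J)"
    using assms by (simp add: sign_avg_sum sum_distrib_left)
  also have "\<dots> \<le> sqrt 2 * (sqrt 2 * M)"
  proof (intro mult_left_mono sign_avg_le)
    show "(\<Sum>i\<in>I. L2_set (?t D i) J) \<le> sqrt 2 * M" for D
      using littlewood_1_2[OF assms(1,2), of M "?t D"] assms(4) by (simp add: bounded3_def lp_norm_1 lp_norm_2)
  qed (use assms in auto)
  finally show ?thesis by (simp flip: mult.assoc)
qed

text \<open>For each choice of signs in the last variable \<open>littlewood_four_thirds\<close> applies; the average over
these choices is compared with the left-hand side by \<open>khinchine_four_thirds\<close>.  This is where the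
sharp constant $2^{1/4}$ enters.\<close>
lemma sum_four_thirds:
  assumes "finite I" "finite J" "finite K" and "bounded3 M I J K a"
  shows "(\<Sum>i\<in>I. \<Sum>j\<in>J. (\<Sum>k\<in>K. a i j k ^ 2) powr (2 / 3)) \<le> (2 powr (3 / 4) * M) powr (4 / 3)"
proof -
  let ?t = "\<lambda>D i j. signed_sum (a i j) K D"
  have M: "0 \<le> M" using bounded3_nonneg[OF assms(4)] .
  have "(\<Sum>i\<in>I. \<Sum>j\<in>J. (\<Sum>k\<in>K. a i j k ^ 2) powr (2 / 3))
      \<le> (\<Sum>i\<in>I. \<Sum>j\<in>J. 2 powr (1 / 3) * sign_avg K (\<lambda>D. \<bar>?t D i j\<bar> powr (4 / 3)))"
    using khinchine_four_thirds[OF assms(3)] by (intro sum_mono) (simp add: rademacher_def)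
  also have "\<dots> = 2 powr (1 / 3) * sign_avg K (\<lambda>D. \<Sum>i\<in>I. \<Sum>j\<in>J. \<bar>?t D i j\<bar> powr (4 / 3))"
    using assms by (simp add: sign_avg_sum sum_distrib_left)
  also have "\<dots> \<le> 2 powr (1 / 3) * (sqrt 2 * M) powr (4 / 3)"
  proof (intro mult_left_mono sign_avg_le)
    fix D
    have "lp_norm (4 / 3) I (\<lambda>i. lp_norm (4 / 3) J (?t D i)) \<le> sqrt 2 * M"
      using assms by (intro littlewood_four_thirds) (auto simp: bounded3_def)
    then have "lp_norm (4 / 3) I (\<lambda>i. lp_norm (4 / 3) J (?t D i)) powr (4 / 3) \<le> (sqrt 2 * M) powr (4 / 3)"
      by (intro powr_mono2) auto
    then show "(\<Sum>i\<in>I. \<Sum>j\<in>J. \<bar>?t D i j\<bar> powr (4 / 3)) \<le> (sqrt 2 * M) powr (4 / 3)"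
      by (simp add: lp_norm_powr)
  qed (use assms in auto)
  also have "\<dots> = (2 powr (3 / 4) * M) powr (4 / 3)"
    using M by (simp add: powr_mult powr_powr powr_half_sqrt[symmetric] flip: powr_add mult.assoc)
  finally show ?thesis .
qed

lemma corner_43_43_2:
  assumes "finite I" "finite J" "finite K" and "bounded3 M I J K a"
  shows "lp_norm (4 / 3) I (\<lambda>i. lp_norm (4 / 3) J (\<lambda>j. lp_norm 2 K (a i j))) \<le> 2 powr (3 / 4) * M"
proof (rule lp_norm_le)
  have "lp_norm 2 K (a i j) powr (4 / 3) = (\<Sum>k\<in>K. a i j k ^ 2) powr (2 / 3)" for i j
    by (simp add: lp_norm_def powr_powr)
  then show "(\<Sum>i\<in>I. \<bar>lp_norm (4 / 3) J (\<lambda>j. lp_norm 2 K (a i j))\<bar> powr (4 / 3)) \<le> (2 powr (3 / 4) * M) powr (4 / 3)"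
    using sum_four_thirds[OF assms] by (simp add: lp_norm_powr)
qed (use bounded3_nonneg[OF assms(4)] in auto)

text \<open>The norm with exponent $2$ in $j$ outside the norm with exponent $4/3$ in $k$ is at most the norm
in the opposite order, by the triangle inequality in $\ell_{3/2}$ for the powers $|a_{ijk}|^{4/3}$;
the latter is the case of \<open>corner_43_43_2\<close> with the last two variables exchanged.\<close>
lemma corner_43_2_43:
  assumes "finite I" "finite J" "finite K" and "bounded3 M I J K a"
  shows "lp_norm (4 / 3) I (\<lambda>i. lp_norm 2 J (\<lambda>j. lp_norm (4 / 3) K (a i j))) \<le> 2 powr (3 / 4) * M"
proof (rule lp_norm_le)
  have "lp_norm 2 J (\<lambda>j. lp_norm (4 / 3) K (a i j)) powr (4 / 3) \<le> (\<Sum>k\<in>K. (\<Sum>j\<in>J. a i j k ^ 2) powr (2 / 3))" for i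
  proof -
    have "lp_norm 2 J (\<lambda>j. lp_norm (4 / 3) K (a i j)) powr (4 / 3)
        = (\<Sum>j\<in>J. (\<Sum>k\<in>K. \<bar>a i j k\<bar> powr (4 / 3)) powr (3 / 2)) powr (2 / 3)"
      by (simp add: lp_norm_def powr_powr flip: powr_numeral)
    also have "\<dots> \<le> (\<Sum>k\<in>K. (\<Sum>j\<in>J. (\<bar>a i j k\<bar> powr (4 / 3)) powr (3 / 2)) powr (2 / 3))"
      using assms by (intro minkowski_three_halves) auto
    also have "\<dots> = (\<Sum>k\<in>K. (\<Sum>j\<in>J. a i j k ^ 2) powr (2 / 3))"
      by (simp add: powr_powr)
    finally show ?thesis .
  qed
  then have "(\<Sum>i\<in>I. \<bar>lp_norm 2 J (\<lambda>j. lp_norm (4 / 3) K (a i j))\<bar> powr (4 / 3))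
      \<le> (\<Sum>i\<in>I. \<Sum>k\<in>K. (\<Sum>j\<in>J. a i j k ^ 2) powr (2 / 3))"
    by (intro sum_mono) simp
  also have "\<dots> \<le> (2 powr (3 / 4) * M) powr (4 / 3)"
    by (rule sum_four_thirds[OF assms(1,3,2) bounded3_swap[OF assms(4)]])
  finally show "(\<Sum>i\<in>I. \<bar>lp_norm 2 J (\<lambda>j. lp_norm (4 / 3) K (a i j))\<bar> powr (4 / 3)) \<le> (2 powr (3 / 4) * M) powr (4 / 3)" .
qed (use bounded3_nonneg[OF assms(4)] in auto)

lemma mixed_interpolation:
  fixes a :: "'a \<Rightarrow> 'b \<Rightarrow> 'c \<Rightarrow> real"
  assumes fin: "finite I" "finite J" "finite K" and uv: "0 \<le> u" "0 \<le> v" "u + v = 1"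
    and pos: "0 < p1" "0 < p2" "0 < p3" "0 < r1" "0 < r2" "0 < r3" "0 < q1" "0 < q2" "0 < q3"
    and eq: "1 / q1 = u / p1 + v / r1" "1 / q2 = u / p2 + v / r2" "1 / q3 = u / p3 + v / r3"
  shows "lp_norm q1 I (\<lambda>i. lp_norm q2 J (\<lambda>j. lp_norm q3 K (a i j)))
    \<le> lp_norm p1 I (\<lambda>i. lp_norm p2 J (\<lambda>j. lp_norm p3 K (a i j))) powr u
      * lp_norm r1 I (\<lambda>i. lp_norm r2 J (\<lambda>j. lp_norm r3 K (a i j))) powr v"
proof -
  have "\<bar>x\<bar> \<le> \<bar>x\<bar> powr u * \<bar>x\<bar> powr v" for x :: real
    using uv by (simp flip: powr_add)
  then have 3: "lp_norm q3 K (a i j) \<le> lp_norm p3 K (a i j) powr u * lp_norm r3 K (a i j) powr v" for i j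
    using fin uv pos eq by (intro lp_norm_interpolation) auto
  have 2: "lp_norm q2 J (\<lambda>j. lp_norm q3 K (a i j))
      \<le> lp_norm p2 J (\<lambda>j. lp_norm p3 K (a i j)) powr u * lp_norm r2 J (\<lambda>j. lp_norm r3 K (a i j)) powr v" for i
    using 3 fin uv pos eq by (intro lp_norm_interpolation) auto
  show ?thesis
    using 2 fin uv pos eq by (intro lp_norm_interpolation) auto
qed

text \<open>First along the edge between the two corners with outer exponent $4/3$, whose constants agree, then
towards the corner $(1,2,2)$; the constants combine to
$2^\theta \cdot 2^{3(1-\theta)/4} = 2^{(\theta+3)/4}$.\<close>
theorem mixed_bound:
  fixes \<tau> \<theta> :: real
  assumes fin: "finite I" "finite J" "finite K" and a: "bounded3 M I J K a"
    and "\<tau> \<in> {0..1}" "\<theta> \<in> {0..1}"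
  shows "lp_norm (4 / (\<theta> + 3)) I (\<lambda>i. lp_norm (4 / (2 + \<tau> - \<theta> * \<tau>)) J (\<lambda>j. lp_norm (4 / (3 + \<theta> * \<tau> - \<theta> - \<tau>)) K (a i j)))
    \<le> 2 powr ((\<theta> + 3) / 4) * M"
proof -
  have M: "0 \<le> M" using bounded3_nonneg[OF a] .
  let ?C = "2 powr (3 / 4) * M"
  have "0 \<le> (1 - \<theta>) * \<tau>" "0 \<le> (1 - \<theta>) * (1 - \<tau>)" using assms by simp_all
  then have pos: "0 < 2 + \<tau> - \<theta> * \<tau>" "0 < 3 + \<theta> * \<tau> - \<theta> - \<tau>"
    by (simp_all add: algebra_simps)
  have "lp_norm (4 / 3) I (\<lambda>i. lp_norm (4 / (2 + \<tau>)) J (\<lambda>j. lp_norm (4 / (3 - \<tau>)) K (a i j)))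
      \<le> lp_norm (4 / 3) I (\<lambda>i. lp_norm (4 / 3) J (\<lambda>j. lp_norm 2 K (a i j))) powr \<tau>
        * lp_norm (4 / 3) I (\<lambda>i. lp_norm 2 J (\<lambda>j. lp_norm (4 / 3) K (a i j))) powr (1 - \<tau>)"
    using assms by (intro mixed_interpolation) (auto simp: field_simps)
  also have "\<dots> \<le> ?C powr \<tau> * ?C powr (1 - \<tau>)"
    using corner_43_43_2[OF fin a] corner_43_2_43[OF fin a] assms
    by (intro mult_mono powr_mono2) auto
  also have "\<dots> = ?C" using M by (simp flip: powr_add)
  finally have edge: "lp_norm (4 / 3) I (\<lambda>i. lp_norm (4 / (2 + \<tau>)) J (\<lambda>j. lp_norm (4 / (3 - \<tau>)) K (a i j))) \<le> ?C" .
  have "lp_norm (4 / (\<theta> + 3)) I (\<lambda>i. lp_norm (4 / (2 + \<tau> - \<theta> * \<tau>)) J (\<lambda>j. lp_norm (4 / (3 + \<theta> * \<tau> - \<theta> - \<tau>)) K (a i j)))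
      \<le> lp_norm 1 I (\<lambda>i. lp_norm 2 J (\<lambda>j. lp_norm 2 K (a i j))) powr \<theta>
        * lp_norm (4 / 3) I (\<lambda>i. lp_norm (4 / (2 + \<tau>)) J (\<lambda>j. lp_norm (4 / (3 - \<tau>)) K (a i j))) powr (1 - \<theta>)"
    using assms pos by (intro mixed_interpolation) (auto simp: field_simps)
  also have "\<dots> \<le> (2 * M) powr \<theta> * ?C powr (1 - \<theta>)"
    using corner_1_2_2[OF fin a] edge assms by (intro mult_mono powr_mono2) auto
  also have "\<dots> = (2 powr \<theta> * 2 powr (3 / 4 * (1 - \<theta>))) * (M powr \<theta> * M powr (1 - \<theta>))"
    using M by (simp only: powr_mult powr_powr mult_ac)
  also have "\<dots> = 2 powr (\<theta> + 3 / 4 * (1 - \<theta>)) * M"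
    unfolding powr_add[symmetric] using M by simp
  also have "\<theta> + 3 / 4 * (1 - \<theta>) = (\<theta> + 3) / 4" by (simp add: field_simps)
  finally show ?thesis .
qed

section \<open>Trilinear forms on the space of null sequences\<close>

lemma coord_sum: "coord (\<Sum>i\<in>A. f i) n = (\<Sum>i\<in>A. coord (f i) n)"
  by (induction A rule: infinite_finite_induct) (simp_all add: zero_c0.rep_eq plus_c0.rep_eq)

lemma bounded_linear_coord: "bounded_linear (\<lambda>x. coord x n)"
  by (rule bounded_linear_intro[where K = 1])
    (simp_all add: plus_c0.rep_eq scaleR_c0.rep_eq abs_coord_le_norm)

text \<open>Continuity at the origin bounds the form by $1$ on a ball of some radius $d$, and the three
arguments are scaled by $d/4$ to bring the unit balls inside it.\<close>
lemma trilinear_bdd: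
  assumes "continuous_trilinear_form T"
  shows "bdd_above {\<bar>T z1 z2 z3\<bar> | z1 z2 z3. norm z1 \<le> 1 \<and> norm z2 \<le> 1 \<and> norm z3 \<le> 1}"
proof -
  have lin: "linear (\<lambda>x. T x y z)" "linear (\<lambda>y. T x y z)" "linear (\<lambda>z. T x y z)" for x y z
    using assms by (auto simp: continuous_trilinear_form_def)
  have zero: "T 0 0 0 = 0" using linear_0[OF lin(1)] .
  have "isCont (\<lambda>(x, y, z). T x y z) (0, 0, 0)"
    using assms by (simp add: continuous_trilinear_form_def continuous_on_eq_continuous_at)
  from this[unfolded continuous_at_eps_delta, rule_format, OF zero_less_one]
  obtain d where d: "d > 0"
    and small: "\<And>p. dist p (0, 0, 0) < d \<Longrightarrow>
      dist (case p of (x, y, z) \<Rightarrow> T x y z) (case (0, 0, 0) of (x, y, z) \<Rightarrow> T x y z) < 1"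
    by blast
  have "\<bar>T x y z\<bar> \<le> (4 / d) ^ 3" if "norm x \<le> 1" "norm y \<le> 1" "norm z \<le> 1" for x y z
  proof -
    let ?r = "d / 4"
    have "norm (?r *\<^sub>R x, ?r *\<^sub>R y, ?r *\<^sub>R z) \<le> norm (?r *\<^sub>R x) + (norm (?r *\<^sub>R y) + norm (?r *\<^sub>R z))"
      by (intro order_trans[OF norm_Pair_le] add_left_mono norm_Pair_le)
    also have "\<dots> \<le> ?r + (?r + ?r)"
      using that d by (intro add_mono) (simp_all add: mult_left_le)
    also have "\<dots> < d" using d by simp
    finally have "dist (?r *\<^sub>R x, ?r *\<^sub>R y, ?r *\<^sub>R z) (0, 0, 0) < d"
      by (simp add: dist_norm)
    from small[OF this] have "\<bar>T (?r *\<^sub>R x) (?r *\<^sub>R y) (?r *\<^sub>R z)\<bar> < 1"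
      by (simp only: prod.case zero dist_real_def diff_0_right)
    also have "T (?r *\<^sub>R x) (?r *\<^sub>R y) (?r *\<^sub>R z) = ?r ^ 3 * T x y z"
      by (simp add: linear_cmul[OF lin(1)] linear_cmul[OF lin(2)] linear_cmul[OF lin(3)] power3_eq_cube)
    finally have "?r ^ 3 * \<bar>T x y z\<bar> < 1" using d by (simp add: abs_mult)
    then have "\<bar>T x y z\<bar> < 1 / ?r ^ 3" using d by (simp add: pos_less_divide_eq mult.commute)
    then show ?thesis using d by (simp add: power_divide)
  qed
  then show ?thesis by (intro bdd_aboveI[of _ "(4 / d) ^ 3"]) blast
qed

lemma abs_le_trilinear_norm:
  assumes "continuous_trilinear_form T" and "norm x \<le> 1" "norm y \<le> 1" "norm z \<le> 1"
  shows "\<bar>T x y z\<bar> \<le> trilinear_norm T"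
  unfolding trilinear_norm_def using assms by (intro cSup_upper trilinear_bdd) auto

definition sign_vector :: "nat \<Rightarrow> nat set \<Rightarrow> c0" where
  "sign_vector N B = (\<Sum>i<N. if i \<in> B then unit_c0 i else - unit_c0 i)"

lemma norm_sign_vector: "norm (sign_vector N B) \<le> 1"
proof (rule norm_c0_leI)
  fix n
  have "coord (sign_vector N B) n = (\<Sum>i<N. if i = n then (if n \<in> B then 1 else - 1) else 0)"
    unfolding sign_vector_def coord_sum
    by (intro sum.cong) (auto simp: unit_c0.rep_eq uminus_c0.rep_eq)
  then show "\<bar>coord (sign_vector N B) n\<bar> \<le> 1" by simp
qed

lemma linear_sign_vector:
  assumes "linear f"
  shows "f (sign_vector N B) = signed_sum (\<lambda>i. f (unit_c0 i)) {..<N} B"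
  unfolding sign_vector_def signed_sum_def linear_sum[OF assms]
  by (intro sum.cong) (auto simp: linear_neg[OF assms])

lemma bounded3_trilinear:
  assumes T: "continuous_trilinear_form T"
  shows "bounded3 (trilinear_norm T) {..<N} {..<N} {..<N} (\<lambda>i j k. T (unit_c0 i) (unit_c0 j) (unit_c0 k))"
  unfolding bounded3_def bounded2_def
proof (intro allI)
  fix B C D
  have lin: "linear (\<lambda>x. T x y z)" "linear (\<lambda>y. T x y z)" "linear (\<lambda>z. T x y z)" for x y z
    using T by (auto simp: continuous_trilinear_form_def)
  have "signed_sum (\<lambda>i. signed_sum (\<lambda>j. signed_sum (\<lambda>k. T (unit_c0 i) (unit_c0 j) (unit_c0 k)) {..<N} D) {..<N} C) {..<N} B
      = T (sign_vector N B) (sign_vector N C) (sign_vector N D)"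
    unfolding linear_sign_vector[OF lin(1)]
    unfolding linear_sign_vector[OF lin(2)]
    unfolding linear_sign_vector[OF lin(3)] ..
  then show "\<bar>signed_sum (\<lambda>i. signed_sum (\<lambda>j. signed_sum (\<lambda>k. T (unit_c0 i) (unit_c0 j) (unit_c0 k)) {..<N} D) {..<N} C) {..<N} B\<bar>
      \<le> trilinear_norm T"
    using abs_le_trilinear_norm[OF T norm_sign_vector norm_sign_vector norm_sign_vector] by simp
qed

lemma mixed_sum_eq_lp_norm:
  assumes "q1 \<noteq> 0" "q2 \<noteq> 0" "q3 \<noteq> 0"
  shows "mixed_sum q1 q2 q3 T N =
    lp_norm q1 {..<N} (\<lambda>i. lp_norm q2 {..<N} (\<lambda>j. lp_norm q3 {..<N} (\<lambda>k. T (unit_c0 i) (unit_c0 j) (unit_c0 k))))"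
  using assms by (simp add: mixed_sum_def lp_norm_def powr_powr)

section \<open>The extremal form and the optimal constant\<close>

text \<open>Two copies of the form $x_0 (y_0 + y_1) + x_1 (y_0 - y_1)$ in separate variables, multiplied by
$z_0 + z_1$ and $z_0 - z_1$.\<close>
definition extremal_form :: "c0 \<Rightarrow> c0 \<Rightarrow> c0 \<Rightarrow> real" where
  "extremal_form x y z =
    (coord z 0 + coord z 1) * (coord x 0 * (coord y 0 + coord y 1) + coord x 1 * (coord y 0 - coord y 1))
    + (coord z 0 - coord z 1) * (coord x 2 * (coord y 2 + coord y 3) + coord x 3 * (coord y 2 - coord y 3))"

lemma continuous_extremal_form: "continuous_trilinear_form extremal_form"
proof -
  have "linear (\<lambda>x. extremal_form x y z)" "linear (\<lambda>y. extremal_form x y z)"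
    "linear (\<lambda>z. extremal_form x y z)" for x y z
    by (rule linearI; simp add: extremal_form_def plus_c0.rep_eq scaleR_c0.rep_eq algebra_simps)+
  moreover have "continuous_on UNIV (\<lambda>(x, y, z). extremal_form x y z)"
    unfolding extremal_form_def case_prod_unfold
    by (intro continuous_intros bounded_linear.continuous_on[OF bounded_linear_coord])
  ultimately show ?thesis by (simp add: continuous_trilinear_form_def)
qed

lemma abs_sum_add_abs_diff_le: "\<bar>a\<bar> \<le> 1 \<Longrightarrow> \<bar>b\<bar> \<le> 1 \<Longrightarrow> \<bar>a + b\<bar> + \<bar>a - b\<bar> \<le> 2" for a b :: real
  by linarith

text \<open>For $|c|, |d| \le 1$ the numbers $c + d$ and $c - d$ cannot both be large:
$|c+d| + |c-d| = 2 \max(|c|,|d|)$.  Used twice, this bounds the extremal form by $4$.\<close>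
lemma hadamard_le:
  fixes a b c d :: real
  assumes "\<bar>a\<bar> \<le> M" "\<bar>b\<bar> \<le> M" "\<bar>c\<bar> \<le> 1" "\<bar>d\<bar> \<le> 1"
  shows "\<bar>(c + d) * a + (c - d) * b\<bar> \<le> 2 * M"
proof -
  have "\<bar>(c + d) * a + (c - d) * b\<bar> \<le> \<bar>c + d\<bar> * \<bar>a\<bar> + \<bar>c - d\<bar> * \<bar>b\<bar>"
    by (simp add: abs_triangle_ineq flip: abs_mult)
  also have "\<dots> \<le> \<bar>c + d\<bar> * M + \<bar>c - d\<bar> * M"
    using assms by (intro add_mono mult_left_mono) auto
  also have "\<dots> = (\<bar>c + d\<bar> + \<bar>c - d\<bar>) * M" by (simp add: distrib_right)
  also have "\<dots> \<le> 2 * M"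
    using assms by (intro mult_right_mono abs_sum_add_abs_diff_le) auto
  finally show ?thesis .
qed

lemma extremal_form_le:
  assumes "norm x \<le> 1" "norm y \<le> 1" "norm z \<le> 1"
  shows "\<bar>extremal_form x y z\<bar> \<le> 4"
proof -
  have c: "\<bar>coord v n\<bar> \<le> 1" if "norm v \<le> 1" for v n
    using abs_coord_le_norm[of v n] that by linarith
  have inner: "\<bar>coord x i * (coord y k + coord y l) + coord x j * (coord y k - coord y l)\<bar> \<le> 2 * 1" for i j k l
    using hadamard_le[of "coord x i" 1 "coord x j" "coord y k" "coord y l"] c assms
    by (simp only: mult.commute)
  have "\<bar>extremal_form x y z\<bar> \<le> 2 * (2 * 1)"
    unfolding extremal_form_def by (rule hadamard_le[OF inner inner c[OF assms(3)] c[OF assms(3)]])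
  then show ?thesis by simp
qed

lemma trilinear_norm_extremal_form: "0 \<le> trilinear_norm extremal_form" "trilinear_norm extremal_form \<le> 4"
proof -
  show "0 \<le> trilinear_norm extremal_form"
    using abs_le_trilinear_norm[OF continuous_extremal_form, of 0 0 0] abs_ge_zero[of "extremal_form 0 0 0"]
    by simp
  have "\<bar>extremal_form 0 0 0\<bar> \<in> {\<bar>extremal_form x y z\<bar> | x y z. norm x \<le> 1 \<and> norm y \<le> 1 \<and> norm z \<le> 1}"
    by (intro CollectI exI[of _ 0]) simp
  then show "trilinear_norm extremal_form \<le> 4"
    unfolding trilinear_norm_def using extremal_form_le by (intro cSup_least) auto
qed

text \<open>The nonzero coefficients have modulus $1$: there are four values of the first index, for each of
them two of the second one, and then two of the third one.\<close>
lemma mixed_sum_extremal_form: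
  assumes "q1 \<noteq> 0" "q2 \<noteq> 0" "q3 \<noteq> 0"
  shows "mixed_sum q1 q2 q3 extremal_form 4 = 4 powr (1 / q1) * 2 powr (1 / q2) * 2 powr (1 / q3)"
proof -
  have four: "(\<Sum>i<4. f i) = f 0 + f 1 + f 2 + f 3" for f :: "nat \<Rightarrow> real"
    by (simp add: eval_nat_numeral)
  have entries: "\<bar>extremal_form (unit_c0 i) (unit_c0 j) (unit_c0 k)\<bar>
      = (if k < 2 \<and> (i < 2 \<and> j < 2 \<or> i \<in> {2, 3} \<and> j \<in> {2, 3}) then 1 else 0)" if "i < 4" "j < 4" "k < 4" for i j k
  proof -
    have "i = 0 \<or> i = 1 \<or> i = 2 \<or> i = 3" "j = 0 \<or> j = 1 \<or> j = 2 \<or> j = 3"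
      "k = 0 \<or> k = 1 \<or> k = 2 \<or> k = 3" using that by arith+
    then show ?thesis
      by (elim disjE) (simp_all add: extremal_form_def unit_c0.rep_eq)
  qed
  have "mixed_sum q1 q2 q3 extremal_form 4 = (4 * (2 * 2 powr (q2 / q3)) powr (q1 / q2)) powr (1 / q1)"
    by (simp add: mixed_sum_def four entries)
  then show ?thesis
    using assms by (simp add: powr_mult powr_powr)
qed

theorem proposition5p1:
  fixes \<tau> \<theta> :: real
  assumes "\<tau> \<in> {0..1}" and "\<theta> \<in> {0..1}"
  shows "optimal_BH_constant
           (4 / (\<theta> + 3)) (4 / (2 + \<tau> - \<theta> * \<tau>)) (4 / (3 + \<theta> * \<tau> - \<theta> - \<tau>))
           (2 powr ((\<theta> + 3) / 4))"
proof -
  let ?q1 = "4 / (\<theta> + 3)" and ?q2 = "4 / (2 + \<tau> - \<theta> * \<tau>)" and ?q3 = "4 / (3 + \<theta> * \<tau> - \<theta> - \<tau>)"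
  have "0 \<le> (1 - \<theta>) * \<tau>" "0 \<le> (1 - \<theta>) * (1 - \<tau>)" using assms by simp_all
  then have "0 < 2 + \<tau> - \<theta> * \<tau>" "0 < 3 + \<theta> * \<tau> - \<theta> - \<tau>"
    by (simp_all add: algebra_simps)
  then have q: "?q1 \<noteq> 0" "?q2 \<noteq> 0" "?q3 \<noteq> 0" using assms by auto
  have "mixed_sum ?q1 ?q2 ?q3 T N \<le> 2 powr ((\<theta> + 3) / 4) * trilinear_norm T"
    if "continuous_trilinear_form T" for T N
    unfolding mixed_sum_eq_lp_norm[OF q]
    by (rule mixed_bound[OF _ _ _ bounded3_trilinear[OF that] assms]) auto
  moreover have "2 powr ((\<theta> + 3) / 4) \<le> C" if "BH_inequality ?q1 ?q2 ?q3 C" for C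
  proof -
    have "4 * 2 powr ((\<theta> + 3) / 4) = 2 powr (2 + (\<theta> + 3) / 4)"
      by (simp add: powr_add)
    also have "2 + (\<theta> + 3) / 4 = 2 * (1 / ?q1) + 1 / ?q2 + 1 / ?q3"
      by (simp add: field_simps)
    also have "2 powr \<dots> = mixed_sum ?q1 ?q2 ?q3 extremal_form 4"
      unfolding mixed_sum_extremal_form[OF q] powr_add by (simp only: powr_powr[symmetric]) simp
    also have "\<dots> \<le> C * trilinear_norm extremal_form"
      using that continuous_extremal_form by (simp add: BH_inequality_def)
    finally have le: "4 * 2 powr ((\<theta> + 3) / 4) \<le> C * trilinear_norm extremal_form" .
    have "0 < 4 * (2 :: real) powr ((\<theta> + 3) / 4)" by simp
    then have "0 < C * trilinear_norm extremal_form" using le by linarith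
    then have "0 \<le> C" using trilinear_norm_extremal_form(1) by (simp add: zero_less_mult_iff)
    then have "C * trilinear_norm extremal_form \<le> C * 4"
      using trilinear_norm_extremal_form(2) by (rule mult_left_mono[rotated])
    then show ?thesis using le by simp
  qed
  ultimately show ?thesis
    by (simp add: optimal_BH_constant_def BH_inequality_def)
qed

end
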